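(* Consider an adapted sequence $\{\boldsymbol{X}_k : k=1,2,3,\dots\}$ and a previsible sequence $\{\boldsymbol{V}_k : k=1,2,3,\dots\}$ of self-adjoint matrices with dimension $d$. Assume these sequences satisfy the relations $$\log \mathbb{E}_{k-1}\, e^{\theta \boldsymbol{X}_k} \preccurlyeq g(\theta)\cdot \boldsymbol{V}_k\quad\text{almost surely for each } \theta>0, \tag{A}$$ where the function $g:(0,\infty)\to[0,\infty]$. In particular, the hypothesis (A) holds when $$\mathbb{E}_{k-1}\, e^{\theta \boldsymbol{X}_k} \preccurlyeq e^{g(\theta)\cdot \boldsymbol{V}_k}\quad\text{almost surely for each } \theta>0.$$ Define the partial sum processes $$\boldsymbol{Y}_k := \sum_{j=1}^k \boldsymbol{X}_j\quad\text{and}\quad \boldsymbol{W}_k := \sum_{j=1}^k \boldsymbol{V}_j,$$ with $\boldsymbol{Y}_0:=\boldsymbol{0}$ and $\boldsymbol{W}_0:=\boldsymbol{0}$. Then, for all $t,w\in\mathbb{R}$, $$\mathbb{P}\left\{\exists\, k\geq 0 : \lambda_{\max}(\boldsymbol{Y}_k)\geq t\ \text{ and }\ \lambda_{\max}(\boldsymbol{W}_k)\leq w\right\} \leq d\cdot \inf_{\theta>0} e^{-\theta t + g(\theta)\cdot w}.$$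
   Context: Let $(\Omega,\mathscr{F},\mathbb{P})$ be a probability space with a filtration $\mathscr{F}_0\subset\mathscr{F}_1\subset\mathscr{F}_2\subset\dots\subset\mathscr{F}$; $\mathbb{E}_k$ denotes expectation conditioned on $\mathscr{F}_k$. A sequence $\{\boldsymbol{X}_k\}$ of random matrices is adapted when each $\boldsymbol{X}_k$ is measurable with respect to $\mathscr{F}_k$, and a sequence $\{\boldsymbol{V}_k\}$ of random matrices is previsible when each $\boldsymbol{V}_k$ is measurable with respect to $\mathscr{F}_{k-1}$. Self-adjoint means Hermitian; $\lambda_{\max}$ is the algebraically largest eigenvalue of a self-adjoint matrix; $\preccurlyeq$ is the semidefinite order ($\boldsymbol{A}\preccurlyeq\boldsymbol{B}$ iff $\boldsymbol{B}-\boldsymbol{A}$ is positive semidefinite). Matrix exponentials and logarithms are the standard ones, the logarithm of a positive-definite matrix being the functional inverse of the exponential. *)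

theory Defs
  imports "HOL-Probability.Probability"
begin

text \<open>
  Complex square matrices of dimension \<open>d = CARD('n)\<close> are elements of \<open>complex ^ 'n ^ 'n\<close>.
  Their library topology, norm and Borel sigma-algebra are the entrywise (Euclidean) ones; the
  pointwise \<open>*\<close> and \<open>\<le>\<close> that the library puts on vector types are not used.
\<close>

definition conj_transpose :: "complex ^ 'n ^ 'n \<Rightarrow> complex ^ 'n ^ 'n" where
  "conj_transpose A = (\<chi> i j. cnj (A $ j $ i))"

definition hermitian_mat :: "complex ^ 'n ^ 'n \<Rightarrow> bool" where
  "hermitian_mat A \<longleftrightarrow> conj_transpose A = A"

text \<open>The quadratic form of a Hermitian matrix is real, so taking its real part loses nothing.\<close>

definition psd_mat :: "complex ^ 'n ^ 'n \<Rightarrow> bool" where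
  "psd_mat A \<longleftrightarrow>
     hermitian_mat A \<and> (\<forall>x. 0 \<le> Re (\<Sum>i\<in>UNIV. cnj (x $ i) * (A *v x) $ i))"

definition loewner_le :: "complex ^ 'n ^ 'n \<Rightarrow> complex ^ 'n ^ 'n \<Rightarrow> bool"
    (infix "\<preceq>\<^sub>L" 50) where
  "A \<preceq>\<^sub>L B \<longleftrightarrow> psd_mat (B - A)"

definition real_eigenvalues :: "complex ^ 'n ^ 'n \<Rightarrow> real set" where
  "real_eigenvalues A = {l. \<exists>v. v \<noteq> 0 \<and> A *v v = complex_of_real l *s v}"

text \<open>
  Meant for Hermitian matrices, whose eigenvalues are all real and form a finite nonempty set.
\<close>

definition lambda_max :: "complex ^ 'n ^ 'n \<Rightarrow> real" where
  "lambda_max A = Max (real_eigenvalues A)"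

primrec mat_pow :: "complex ^ 'n ^ 'n \<Rightarrow> nat \<Rightarrow> complex ^ 'n ^ 'n" where
  "mat_pow A 0 = mat 1"
| "mat_pow A (Suc n) = A ** mat_pow A n"

definition mat_exp :: "complex ^ 'n ^ 'n \<Rightarrow> complex ^ 'n ^ 'n" where
  "mat_exp A = (\<Sum>n. (1 / fact n) *\<^sub>R mat_pow A n)"

text \<open>
  Meant for positive-definite matrices: on these it inverts \<open>mat_exp\<close>, which maps the Hermitian
  matrices bijectively onto the positive-definite ones.  Among all complex matrices the logarithm
  would not be unique.
\<close>

definition mat_log :: "complex ^ 'n ^ 'n \<Rightarrow> complex ^ 'n ^ 'n" where
  "mat_log P = (THE L. hermitian_mat L \<and> mat_exp L = P)"

definition mat_cond_exp ::
    "'a measure \<Rightarrow> 'a measure \<Rightarrow> ('a \<Rightarrow> complex ^ 'n ^ 'n) \<Rightarrow> 'a \<Rightarrow> complex ^ 'n ^ 'n" where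
  "mat_cond_exp M F Z \<omega> =
     (\<chi> i j. Complex (real_cond_exp M F (\<lambda>\<omega>'. Re (Z \<omega>' $ i $ j)) \<omega>)
                    (real_cond_exp M F (\<lambda>\<omega>'. Im (Z \<omega>' $ i $ j)) \<omega>))"

text \<open>
  The conditional expectation of \<open>Z\<close> given \<open>F\<close> exists as a finite matrix, almost surely.  This is
  implied by integrability of \<open>Z\<close> but is weaker.  Since \<open>real_cond_exp\<close> is the difference of
  the conditional expectations of the positive and the negative part, computed in \<open>[0,\<infinity>]\<close>, it has
  its intended value under this condition; where an extended conditional expectation is infinite,
  \<open>real_cond_exp\<close> would silently replace it by 0.
\<close>

definition cond_integrable ::
    "'a measure \<Rightarrow> 'a measure \<Rightarrow> ('a \<Rightarrow> complex ^ 'n ^ 'n) \<Rightarrow> bool" where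
  "cond_integrable M F Z \<longleftrightarrow>
     Z \<in> borel_measurable M \<and> (AE \<omega> in M. nn_cond_exp M F (\<lambda>\<omega>'. ennreal (norm (Z \<omega>'))) \<omega> < \<infinity>)"

text \<open>
  \<open>exp_bound c \<theta> t w\<close> is \<open>exp (- \<theta> t + c w)\<close> for \<open>c \<in> [0,\<infinity>]\<close>.  The value \<open>c = \<infinity>\<close> stands for
  the absence of a bound, so the result is then \<open>\<infinity>\<close> for every \<open>w\<close>, also for \<open>w \<le> 0\<close>.  This is the
  convention that matches hypotheses which impose nothing where the coefficient is infinite; with
  \<open>\<infinity> * w = -\<infinity>\<close> for \<open>w < 0\<close>, or \<open>\<infinity> * 0 = 0\<close>, a tail bound derived from them would be false.
\<close>

definition exp_bound :: "ennreal \<Rightarrow> real \<Rightarrow> real \<Rightarrow> real \<Rightarrow> ennreal" where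
  "exp_bound c \<theta> t w =
     (if c = \<infinity> then \<infinity> else ennreal (exp (- \<theta> * t + enn2real c * w)))"

end

theory Submission
  imports Defs
begin

text \<open>
  The process \<open>tr exp (\<theta> Y\<^sub>k - g(\<theta>) W\<^sub>k)\<close> is a nonnegative supermartingale, starts at
  \<open>d\<close>, and is at least \<open>exp (\<theta> t - g(\<theta>) w)\<close> as soon as \<open>lambda_max Y\<^sub>k \<ge> t\<close>
  and \<open>lambda_max W\<^sub>k \<le> w\<close>; the maximal inequality then gives the tail bound.

  The supermartingale property is Jensen's inequality for \<open>A \<mapsto> tr exp (H + log A)\<close>, whose
  concavity is Lieb's theorem.  Following Tropp, Lieb's theorem is derived from the joint convexity of
  the quantum relative entropy \<open>D(T; A) = tr T (log T - log A)\<close> through the variational formula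
  \<open>tr exp (H + log A) = max\<^sub>T (tr T H + tr T - D(T; A))\<close>.  The relative entropy is an integral over
  \<open>s \<ge> 0\<close> of suprema of forms that are linear in \<open>(T, A)\<close>, which makes it subadditive in
  \<open>(T, A)\<close> and antitone in \<open>A\<close>; the latter also yields the operator monotonicity of the logarithm.

  Since \<open>H\<close> is random, the conditional Jensen inequality is localised: near each pair \<open>(H, B)\<close> one
  deterministic linear functional dominates \<open>tr exp (H' + log A)\<close> for all \<open>A\<close> and is nearly attained at
  \<open>B'\<close>, and countably many such neighbourhoods suffice.
\<close>

section \<open>Spectral theorem\<close>

text \<open>For noncommuting matrices the exponential of a sum does not factor, and the
  Golden-Thompson bound tr e^(A+B) \<le> tr e^A e^B has no analogue for three summands, so the
  newest increment cannot be split off from the past as in the scalar argument; concavity in A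
  replaces the factorisation. Relative entropy and \<open>lieb H\<close> are homogeneous of degree
  one, so convexity and concavity become sub- and superadditivity, and the functionals that support
  \<open>lieb H\<close> are linear, not affine. This suits the conditional step: e^(theta X) need
  not be integrable, but a functional that is nonnegative on positive-definite matrices can be
  integrated in [0,\<infinity>] and passes to \<open>mat_cond_exp\<close>. Because
  \<open>lieb\<close> is strictly positive, the error of the localisation can be a factor
  \<open>exp e\<close>, the same for all neighbourhoods, which disappears as e tends to 0. The trace
  inequalities reduce to scalar ones: for T and A with eigenbases U and W, the traces are sums over
  pairs of eigenvalues with the doubly stochastic weights \<open>overlap U W i j\<close>.\<close>

lemma conj_transpose_nth [simp]: "conj_transpose A $ i $ j = cnj (A $ j $ i)"
  by (simp add: conj_transpose_def)

lemma conj_transpose_twice [simp]: "conj_transpose (conj_transpose A) = A"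
  by (simp add: vec_eq_iff)

lemma conj_transpose_mult: "conj_transpose (A ** B) = conj_transpose B ** conj_transpose A"
  by (simp add: vec_eq_iff matrix_matrix_mult_def mult.commute)

lemma conj_transpose_linear [simp]:
  "conj_transpose (A + B) = conj_transpose A + conj_transpose B"
  "conj_transpose (A - B) = conj_transpose A - conj_transpose B"
  "conj_transpose (c *\<^sub>R A) = c *\<^sub>R conj_transpose A"
  "conj_transpose 0 = 0" "conj_transpose (mat 1) = mat 1"
  by (auto simp: vec_eq_iff mat_def)

definition unitary_mat :: "complex ^ 'n ^ 'n \<Rightarrow> bool" where
  "unitary_mat U \<longleftrightarrow> conj_transpose U ** U = mat 1 \<and> U ** conj_transpose U = mat 1"

definition diag_mat :: "('n \<Rightarrow> real) \<Rightarrow> complex ^ 'n ^ 'n" where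
  "diag_mat l = (\<chi> i j. if i = j then of_real (l i) else 0)"

text \<open>The eigenvalues are an arbitrary function on the index type, so for fixed unitary
  \<open>U\<close> sums, products and exponentials act on \<open>l\<close> alone.\<close>

definition spectral_mat :: "complex ^ 'n ^ 'n \<Rightarrow> ('n \<Rightarrow> real) \<Rightarrow> complex ^ 'n ^ 'n" where
  "spectral_mat U l = U ** diag_mat l ** conj_transpose U"

definition quad_form :: "complex ^ 'n ^ 'n \<Rightarrow> complex ^ 'n \<Rightarrow> real" where
  "quad_form A x = Re (\<Sum>i\<in>UNIV. cnj (x $ i) * (A *v x) $ i)"

lemma inner_complex_vec: "x \<bullet> y = Re (\<Sum>i\<in>UNIV. cnj (x $ i) * y $ i)" for x y :: "complex ^ 'n"
  by (simp add: inner_vec_def inner_complex_def)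

lemma quad_form_inner: "quad_form A x = x \<bullet> (A *v x)"
  by (simp add: quad_form_def inner_complex_vec)

lemma inner_conj_transpose: "(conj_transpose A *v x) \<bullet> y = x \<bullet> (A *v y)"
proof -
  have "(\<Sum>i\<in>UNIV. cnj ((conj_transpose A *v x) $ i) * y $ i)
      = (\<Sum>i\<in>UNIV. \<Sum>j\<in>UNIV. A $ j $ i * cnj (x $ j) * y $ i)"
    by (simp add: matrix_vector_mult_def sum_distrib_right)
  also have "\<dots> = (\<Sum>j\<in>UNIV. \<Sum>i\<in>UNIV. A $ j $ i * cnj (x $ j) * y $ i)"
    by (rule sum.swap)
  also have "\<dots> = (\<Sum>i\<in>UNIV. cnj (x $ i) * (A *v y) $ i)"
    by (simp add: matrix_vector_mult_def sum_distrib_left mult_ac)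
  finally show ?thesis by (simp add: inner_complex_vec)
qed

lemma inner_hermitian: "hermitian_mat A \<Longrightarrow> (A *v x) \<bullet> y = x \<bullet> (A *v y)"
  using inner_conj_transpose[of A x y] by (simp add: hermitian_mat_def)

lemma psd_mat_alt: "psd_mat A \<longleftrightarrow> hermitian_mat A \<and> (\<forall>x. 0 \<le> quad_form A x)"
  by (simp add: psd_mat_def quad_form_def)

lemma matrix_vector_mult_scale:
  "A *v (c *s x) = c *s (A *v x)" for A :: "complex ^ 'n ^ 'm"
  by (simp add: vec_eq_iff matrix_vector_mult_def sum_distrib_left mult_ac)

lemma scaleR_eq_scalar: "r *\<^sub>R x = complex_of_real r *s x" for x :: "complex ^ 'n"
  by (simp add: vec_eq_iff complex_eq_iff)

lemma matrix_vector_scaleR: "A *v (r *\<^sub>R x) = r *\<^sub>R (A *v x)" for A :: "complex ^ 'n ^ 'm"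
  by (simp add: scaleR_eq_scalar matrix_vector_mult_scale)

definition cinner :: "complex ^ 'n \<Rightarrow> complex ^ 'n \<Rightarrow> complex" where
  "cinner x y = (\<Sum>i\<in>UNIV. cnj (x $ i) * y $ i)"

text \<open>Complex orthogonality to \<open>x\<close> is real orthogonality to both \<open>x\<close>
  and \<open>\<i> *s x\<close>, which makes real subspaces and dimensions usable for complex
  vectors.\<close>

lemma cinner_Complex: "cinner x y = Complex (x \<bullet> y) ((\<i> *s x) \<bullet> y)"
proof -
  have "Im (\<Sum>i\<in>UNIV. cnj (x $ i) * y $ i) = Re (\<Sum>i\<in>UNIV. cnj (\<i> * x $ i) * y $ i)"
    unfolding Re_sum Im_sum by (rule sum.cong) auto
  then show ?thesis
    by (simp add: cinner_def inner_complex_vec complex_eq_iff)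
qed

text \<open>A maximiser of the Rayleigh quotient on an invariant subspace is an eigenvector.\<close>

lemma hermitian_eigenvector_in_subspace:
  fixes A :: "complex ^ 'n ^ 'n"
  assumes herm: "hermitian_mat A" and sub: "subspace W" and ne: "\<exists>x\<in>W. x \<noteq> 0"
    and cW: "\<And>x. x \<in> W \<Longrightarrow> A *v x \<in> W"
  shows "\<exists>x\<in>W. \<exists>l. norm x = 1 \<and> A *v x = complex_of_real l *s x"
proof -
  let ?K = "W \<inter> sphere 0 1"
  have "compact ?K"
    using closed_subspace[OF sub] by (simp add: closed_Int_compact)
  moreover have "?K \<noteq> {}"
  proof -
    obtain x where "x \<in> W" "x \<noteq> 0" using ne by auto
    then have "(1 / norm x) *\<^sub>R x \<in> ?K" using sub by (simp add: subspace_scale)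
    then show ?thesis by blast
  qed
  moreover have "continuous_on ?K (\<lambda>x. x \<bullet> (A *v x))"
    by (intro continuous_intros)
  ultimately obtain x where x: "x \<in> W" "norm x = 1"
    and mx: "\<And>y. y \<in> ?K \<Longrightarrow> y \<bullet> (A *v y) \<le> x \<bullet> (A *v x)"
    using continuous_attains_sup[of ?K "\<lambda>x. x \<bullet> (A *v x)"] by (metis Int_iff mem_sphere_0)
  define m where "m = x \<bullet> (A *v x)"
  have le: "y \<bullet> (A *v y) \<le> m * (norm y)\<^sup>2" if "y \<in> W" for y
  proof (cases "y = 0")
    case False
    have "(1 / norm y) *\<^sub>R y \<in> ?K" using that False sub by (simp add: subspace_scale)
    from mx[OF this] have "(y \<bullet> (A *v y)) / (norm y)\<^sup>2 \<le> m"
      by (simp add: m_def matrix_vector_scaleR power2_eq_square)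
    then show ?thesis using False by (simp add: field_simps)
  qed (simp)
  define y where "y = A *v x - m *\<^sub>R x"
  have yW: "y \<in> W" using cW[OF x(1)] x(1) sub by (simp add: y_def subspace_diff subspace_scale)
  \<comment> \<open>Compare the maximiser with \<open>x + t *\<^sub>R y\<close>, where
    \<open>y\<close> is the residual of the eigenvalue equation. The first-order gain is
    \<open>2 * t * (norm y)\<^sup>2\<close>, and only a quadratic term opposes it.\<close>
  have ineq: "2 * t * (norm y)\<^sup>2 \<le> t\<^sup>2 * (m * (norm y)\<^sup>2 - y \<bullet> (A *v y))" for t :: real
  proof -
    have "x + t *\<^sub>R y \<in> W" using x yW sub by (simp add: subspace_add subspace_scale)
    from le[OF this]
    have "(x + t *\<^sub>R y) \<bullet> (A *v (x + t *\<^sub>R y)) \<le> m * ((x + t *\<^sub>R y) \<bullet> (x + t *\<^sub>R y))"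
      by (simp add: power2_norm_eq_inner)
    moreover have "x \<bullet> (A *v y) = y \<bullet> (A *v x)"
      using inner_hermitian[OF herm, of x y] by (simp add: inner_commute)
    moreover have "x \<bullet> x = 1" using x by (simp add: norm_eq_1)
    ultimately have "2 * t * (y \<bullet> (A *v x) - m * (x \<bullet> y)) \<le> t\<^sup>2 * (m * (y \<bullet> y) - y \<bullet> (A *v y))"
      by (simp add: matrix_vector_right_distrib matrix_vector_scaleR inner_add_left
          inner_add_right m_def[symmetric] algebra_simps power2_eq_square inner_commute)
    moreover have "y \<bullet> (A *v x) - m * (x \<bullet> y) = y \<bullet> y"
      unfolding y_def by (simp add: inner_diff_left inner_diff_right inner_commute algebra_simps)
    ultimately show ?thesis by (simp add: power2_norm_eq_inner)
  qed
  have "y = 0"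
  proof (rule ccontr)
    assume "y \<noteq> 0"
    define c where "c = m * (norm y)\<^sup>2 - y \<bullet> (A *v y)"
    define n where "n = (norm y)\<^sup>2"
    have n: "n > 0" using \<open>y \<noteq> 0\<close> by (simp add: n_def)
    have i: "2 * t * n \<le> t\<^sup>2 * c" for t using ineq[of t] by (simp add: c_def n_def)
    from le[OF yW] have c0: "0 \<le> c" by (simp add: c_def)
    \<comment> \<open>A value of t small enough for the linear term to win: with
      \<open>n = d * (1 + c)\<close> the inequality at t = d becomes
      \<open>2 + 2 * c \<le> c\<close>.\<close>
    define d where "d = n / (1 + c)"
    have d: "d > 0" "n = d * (1 + c)" using n c0 by (auto simp: d_def field_simps)
    have "(d * d) * (2 + 2 * c) \<le> (d * d) * c" using i[of d] by (simp add: d(2) power2_eq_square algebra_simps)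
    then have "2 + 2 * c \<le> c" using d(1) by (simp add: mult_le_cancel_left)
    then show False using c0 by simp
  qed
  then show ?thesis using x by (intro bexI[of _ x] exI[of _ m]) (auto simp: y_def scaleR_eq_scalar)
qed

text \<open>Induction on the number of orthonormal eigenvectors found so far: their orthogonal
  complement is invariant under \<open>A\<close>, and it is nonzero because they occupy at most 2k
  of the 2d real dimensions.\<close>

lemma hermitian_eigenvectors:
  fixes A :: "complex ^ 'n ^ 'n"
  assumes herm: "hermitian_mat A"
  shows "k \<le> CARD('n) \<Longrightarrow> \<exists>u l. (\<forall>i<k. \<forall>j<k. cinner (u i) (u j) = (if i = j then 1 else 0))
            \<and> (\<forall>i<k. A *v u i = complex_of_real (l i) *s u i)"
proof (induction k)
  case (Suc k)
  then obtain u l where u: "\<And>i j. i < k \<Longrightarrow> j < k \<Longrightarrow> cinner (u i) (u j) = (if i = j then 1 else 0)"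
    and e: "\<And>i. i < k \<Longrightarrow> A *v u i = complex_of_real (l i) *s u i" by auto
  let ?B = "u ` {..<k} \<union> (\<lambda>i. \<i> *s u i) ` {..<k}"
  let ?W = "{x. \<forall>b\<in>?B. b \<bullet> x = 0}"
  have "dim ?B \<le> card ?B" by (rule dim_le_card') simp
  also have "\<dots> \<le> card (u ` {..<k}) + card ((\<lambda>i. \<i> *s u i) ` {..<k})" by (rule card_Un_le)
  also have "\<dots> \<le> k + k" using card_image_le[of "{..<k}" u] card_image_le[of "{..<k}" "\<lambda>i. \<i> *s u i"]
    by simp
  also have "\<dots> < DIM(complex ^ 'n)" using Suc.prems by simp
  finally obtain x where "x \<noteq> 0" "\<And>y. y \<in> span ?B \<Longrightarrow> orthogonal x y"
    using orthogonal_to_subspace_exists[of ?B] by blast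
  then have ne: "\<exists>x\<in>?W. x \<noteq> 0"
    by (intro bexI[of _ x]) (auto simp: orthogonal_def inner_commute span_base)
  have sub: "subspace ?W" by (auto simp: subspace_def inner_add_right)
  have W: "x \<in> ?W \<longleftrightarrow> (\<forall>i<k. cinner (u i) x = 0)" for x
    by (auto simp: cinner_Complex complex_eq_iff)
  have "A *v x \<in> ?W" if "x \<in> ?W" for x
  proof -
    have "b \<bullet> (A *v x) = (A *v b) \<bullet> x" for b using inner_hermitian[OF herm] by simp
    moreover have "(A *v b) \<bullet> x = 0" if b: "b \<in> ?B" for b
    proof -
      obtain i where i: "i < k" "b = u i \<or> b = \<i> *s u i" using b by auto
      then have "A *v b = l i *\<^sub>R b"
        using e[OF i(1)]
        by (auto simp: matrix_vector_mult_scale scaleR_eq_scalar vector_smult_assoc mult.commute)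
      then show ?thesis using \<open>x \<in> ?W\<close> b by simp
    qed
    ultimately show ?thesis by simp
  qed
  from hermitian_eigenvector_in_subspace[OF herm sub ne this]
  obtain x m where x: "x \<in> ?W" "norm x = 1" "A *v x = complex_of_real m *s x" by blast
  have 1: "cinner x x = 1"
  proof -
    have "(\<i> *s x) \<bullet> x = 0"
      by (simp add: inner_vec_def inner_complex_def)
    then show ?thesis using x(2) by (simp add: cinner_Complex complex_eq_iff norm_eq_1)
  qed
  have 2: "cinner y x = cnj (cinner x y)" for y
    by (simp add: cinner_def mult.commute)
  have 3: "cinner (u i) x = 0" "cinner x (u i) = 0" if "i < k" for i
  proof -
    show "cinner (u i) x = 0" using x(1) W that by blast
    then show "cinner x (u i) = 0" using 2[of "u i"] by simp
  qed
  show ?case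
    by (rule exI[of _ "u(k := x)"], rule exI[of _ "l(k := m)"])
       (use u e x 1 3 in \<open>auto simp: less_Suc_eq\<close>)
qed simp

theorem hermitian_spectral:
  fixes A :: "complex ^ 'n ^ 'n"
  assumes "hermitian_mat A"
  obtains U l where "unitary_mat U" "A = spectral_mat U l"
proof -
  obtain u l where u: "\<And>i j. i < CARD('n) \<Longrightarrow> j < CARD('n) \<Longrightarrow> cinner (u i) (u j) = (if i = j then 1 else 0)"
    and e: "\<And>i. i < CARD('n) \<Longrightarrow> A *v u i = complex_of_real (l i) *s u i"
    using hermitian_eigenvectors[OF assms order_refl] by blast
  obtain h :: "'n \<Rightarrow> nat" where h: "bij_betw h UNIV {0..<CARD('n)}"
    using ex_bij_betw_finite_nat[of "UNIV :: 'n set"] by auto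
  then have hl: "h i < CARD('n)" for i by (auto dest: bij_betwE)
  have hi: "h i = h j \<longleftrightarrow> i = j" for i j using h by (auto simp: bij_betw_def inj_def)
  define U where "U = (\<chi> i j. u (h j) $ i)"
  have cU: "conj_transpose U ** U = mat 1"
    using u[OF hl hl] by (simp add: vec_eq_iff matrix_matrix_mult_def U_def mat_def cinner_def hi)
  then have U: "unitary_mat U"
    using matrix_left_right_inverse by (auto simp: unitary_mat_def)
  have "A ** U = U ** diag_mat (l \<circ> h)"
  proof -
    have "(A ** U) $ i $ j = (A *v u (h j)) $ i" for i j
      by (simp add: matrix_matrix_mult_def matrix_vector_mult_def U_def)
    also have "\<dots> i j = (U ** diag_mat (l \<circ> h)) $ i $ j" for i j
      by (simp add: e[OF hl] matrix_matrix_mult_def U_def diag_mat_def if_distrib if_distribR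
          sum.delta cong: if_cong)
    finally show ?thesis by (simp add: vec_eq_iff)
  qed
  then have "A ** (U ** conj_transpose U) = spectral_mat U (l \<circ> h)"
    by (simp add: matrix_mul_assoc spectral_mat_def)
  then have "A = spectral_mat U (l \<circ> h)" using U by (simp add: unitary_mat_def)
  then show ?thesis using U that by blast
qed

section \<open>Functional calculus\<close>

lemma diag_mat_mult_nth [simp]:
  "(diag_mat l ** X) $ i $ j = of_real (l i) * X $ i $ j"
  "(X ** diag_mat l) $ i $ j = X $ i $ j * of_real (l j)"
  by (simp_all add: matrix_matrix_mult_def diag_mat_def if_distrib if_distribR cong: if_cong)

lemma diag_mat_vector_nth [simp]: "(diag_mat l *v x) $ i = of_real (l i) * x $ i"
  by (simp add: matrix_vector_mult_def diag_mat_def if_distrib if_distribR cong: if_cong)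

lemma diag_mat_mult: "diag_mat l ** diag_mat m = diag_mat (\<lambda>i. l i * m i)"
  unfolding vec_eq_iff diag_mat_mult_nth by (simp add: diag_mat_def)

lemma spectral_mat_nth:
  "spectral_mat U l $ a $ b = (\<Sum>i\<in>UNIV. l i *\<^sub>R (U $ a $ i * cnj (U $ b $ i)))"
  unfolding spectral_mat_def matrix_matrix_mult_def[of "U ** diag_mat l"]
  by (simp add: scaleR_conv_of_real mult_ac)

lemma hermitian_spectral_mat [simp]: "hermitian_mat (spectral_mat U l)"
  by (simp add: hermitian_mat_def vec_eq_iff spectral_mat_nth mult_ac)

lemma spectral_mat_linear:
  "spectral_mat U l + spectral_mat U m = spectral_mat U (\<lambda>i. l i + m i)"
  "spectral_mat U l - spectral_mat U m = spectral_mat U (\<lambda>i. l i - m i)"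
  "c *\<^sub>R spectral_mat U l = spectral_mat U (\<lambda>i. c * l i)"
  by (simp_all add: vec_eq_iff spectral_mat_nth scaleR_add_left scaleR_diff_left scaleR_sum_right
      sum.distrib sum_subtractf)

lemma unitary_cancel:
  assumes "unitary_mat U"
  shows "conj_transpose U ** (U ** X) = X" "U ** (conj_transpose U ** X) = X"
    "conj_transpose U ** U = mat 1" "U ** conj_transpose U = mat 1"
  using assms by (simp_all add: unitary_mat_def matrix_mul_assoc)

lemma spectral_mat_mult:
  assumes "unitary_mat U"
  shows "spectral_mat U l ** spectral_mat U m = spectral_mat U (\<lambda>i. l i * m i)"
  unfolding diag_mat_mult[symmetric] spectral_mat_def
  by (simp add: matrix_mul_assoc[symmetric] unitary_cancel[OF assms])

lemma spectral_mat_const: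
  fixes U :: "complex ^ 'n ^ 'n"
  assumes "unitary_mat U"
  shows "spectral_mat U (\<lambda>_. c) = c *\<^sub>R mat 1"
proof -
  have "diag_mat (\<lambda>_. 1) = (mat 1 :: complex ^ 'n ^ 'n)" by (simp add: vec_eq_iff diag_mat_def mat_def)
  then have "spectral_mat U (\<lambda>_. 1) = mat 1"
    using assms by (simp add: spectral_mat_def unitary_mat_def)
  then show ?thesis using spectral_mat_linear(3)[of c U "\<lambda>_. 1"] by simp
qed

lemma mat_pow_spectral_mat:
  assumes "unitary_mat U"
  shows "mat_pow (spectral_mat U l) n = spectral_mat U (\<lambda>i. l i ^ n)"
  by (induction n) (simp_all add: spectral_mat_mult[OF assms] spectral_mat_const[OF assms])

lemma sums_vec: "(\<And>i. (\<lambda>n. f n $ i) sums (s $ i)) \<Longrightarrow> f sums s"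
  unfolding sums_def using vec_tendstoI[of "\<lambda>n. sum f {..<n}" s] by simp

lemma mat_exp_spectral_mat:
  assumes "unitary_mat U"
  shows "mat_exp (spectral_mat U l) = spectral_mat U (\<lambda>i. exp (l i))"
proof -
  have "(\<lambda>n. (1 / fact n) *\<^sub>R mat_pow (spectral_mat U l) n) sums spectral_mat U (\<lambda>i. exp (l i))"
    unfolding mat_pow_spectral_mat[OF assms] spectral_mat_linear
  proof (rule sums_vec, rule sums_vec)
    fix a b
    have "(\<lambda>n. 1 / fact n * l i ^ n) sums exp (l i)" for i
      using exp_converges[of "l i"] by (simp add: field_simps)
    then show "(\<lambda>n. spectral_mat U (\<lambda>i. 1 / fact n * l i ^ n) $ a $ b) sums
        (spectral_mat U (\<lambda>i. exp (l i)) $ a $ b)"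
      unfolding spectral_mat_nth by (intro sums_sum sums_scaleR_left)
  qed
  then show ?thesis by (simp add: mat_exp_def sums_iff)
qed

text \<open>The eigenvalue equation forces \<open>C = U\<^sup>* W\<close> to vanish off the pairs of equal eigenvalues.\<close>

lemma mat_exp_inj:
  assumes "hermitian_mat K" "hermitian_mat L" and eq: "mat_exp K = mat_exp L"
  shows "K = L"
proof -
  obtain U k where U: "unitary_mat U" and K: "K = spectral_mat U k"
    using hermitian_spectral[OF assms(1)] .
  obtain W l where W: "unitary_mat W" and L: "L = spectral_mat W l"
    using hermitian_spectral[OF assms(2)] .
  let ?C = "conj_transpose U ** W"
  have *: "conj_transpose U ** spectral_mat U a ** W = diag_mat a ** ?C"
    "conj_transpose U ** spectral_mat W b ** W = ?C ** diag_mat b" for a b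
    by (simp_all add: spectral_mat_def matrix_mul_assoc[symmetric] unitary_cancel[OF U] unitary_cancel[OF W])
  have "diag_mat (\<lambda>i. exp (k i)) ** ?C = ?C ** diag_mat (\<lambda>i. exp (l i))"
    using eq unfolding K L mat_exp_spectral_mat[OF U] mat_exp_spectral_mat[OF W] by (metis *)
  then have "of_real (exp (k i)) * ?C $ i $ j = ?C $ i $ j * of_real (exp (l j))" for i j
    by (metis diag_mat_mult_nth)
  then have "?C $ i $ j = 0 \<or> k i = l j" for i j
    by (metis exp_inj_iff mult.commute mult_cancel_left of_real_eq_iff)
  then have "of_real (k i) * ?C $ i $ j = ?C $ i $ j * of_real (l j)" for i j
    by (metis mult.commute mult_zero_left)
  then have "diag_mat k ** ?C = ?C ** diag_mat l" by (simp add: vec_eq_iff)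
  then have "conj_transpose U ** K ** W = conj_transpose U ** L ** W" unfolding K L by (simp add: *)
  then have "U ** (conj_transpose U ** K ** W) ** conj_transpose W
      = U ** (conj_transpose U ** L ** W) ** conj_transpose W" by simp
  then show ?thesis
    by (simp add: matrix_mul_assoc[symmetric] unitary_cancel[OF U] unitary_cancel[OF W])
qed

lemma mat_log_mat_exp: "hermitian_mat L \<Longrightarrow> mat_log (mat_exp L) = L"
  unfolding mat_log_def by (rule the_equality) (auto intro: mat_exp_inj)

lemma mat_log_spectral_mat:
  assumes "unitary_mat U" "\<And>i. l i > 0"
  shows "mat_log (spectral_mat U l) = spectral_mat U (\<lambda>i. ln (l i))"
  using mat_log_mat_exp[of "spectral_mat U (\<lambda>i. ln (l i))"] assms
  by (simp add: mat_exp_spectral_mat)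

section \<open>Quadratic forms and positive-definite matrices\<close>

lemma scaleR_matrix_vector: "(c *\<^sub>R A) *v x = c *\<^sub>R (A *v x)" for A :: "complex ^ 'n ^ 'm"
  by (simp add: vec_eq_iff matrix_vector_mult_def scaleR_sum_right)

lemma quad_form_linear:
  "quad_form (A + B) x = quad_form A x + quad_form B x"
  "quad_form (A - B) x = quad_form A x - quad_form B x"
  "quad_form (c *\<^sub>R A) x = c * quad_form A x"
  "quad_form 0 x = 0"
  "quad_form (mat 1) x = (norm x)\<^sup>2"
  by (simp_all add: quad_form_inner matrix_vector_mult_add_rdistrib matrix_vector_mult_diff_rdistrib
      inner_add_right inner_diff_right scaleR_matrix_vector power2_norm_eq_inner)

lemma hermitian_mat_linear:
  "hermitian_mat A \<Longrightarrow> hermitian_mat B \<Longrightarrow> hermitian_mat (A + B)"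
  "hermitian_mat A \<Longrightarrow> hermitian_mat B \<Longrightarrow> hermitian_mat (A - B)"
  "hermitian_mat A \<Longrightarrow> hermitian_mat (c *\<^sub>R A)"
  "hermitian_mat 0" "hermitian_mat (mat 1)"
  by (simp_all add: hermitian_mat_def)

lemma hermitian_mat_sum: "(\<And>i. i \<in> I \<Longrightarrow> hermitian_mat (A i)) \<Longrightarrow> hermitian_mat (\<Sum>i\<in>I. A i)"
  by (induction I rule: infinite_finite_induct) (auto intro: hermitian_mat_linear)

lemma quad_form_spectral_mat:
  "quad_form (spectral_mat U l) x = (\<Sum>i\<in>UNIV. l i * (cmod ((conj_transpose U *v x) $ i))\<^sup>2)"
proof -
  let ?y = "conj_transpose U *v x"
  have "quad_form (spectral_mat U l) x = ?y \<bullet> (diag_mat l *v ?y)"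
    using inner_conj_transpose[of "conj_transpose U" "diag_mat l *v ?y" x]
    by (simp add: quad_form_inner spectral_mat_def matrix_vector_mul_assoc[symmetric] inner_commute)
  also have "diag_mat l *v ?y = (\<chi> i. l i *\<^sub>R ?y $ i)"
    by (simp add: vec_eq_iff scaleR_conv_of_real)
  finally show ?thesis
    by (simp add: inner_vec_def power2_norm_eq_inner)
qed

lemma norm_unitary:
  assumes "unitary_mat U"
  shows "(\<Sum>i\<in>UNIV. (cmod ((conj_transpose U *v x) $ i))\<^sup>2) = (norm x)\<^sup>2"
  using quad_form_spectral_mat[of U "\<lambda>_. 1" x] by (simp add: spectral_mat_const[OF assms] quad_form_linear)

text \<open>The i-th column of \<open>U\<close> serves all \<open>l\<close> at once; testing with it
  turns order relations between matrices into relations between eigenvalues.\<close>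

lemma quad_form_eigenvector:
  fixes U :: "complex ^ 'n ^ 'n"
  assumes "unitary_mat U"
  obtains x where "norm x = 1" "x \<noteq> 0" "\<And>l. quad_form (spectral_mat U l) x = l i"
    "\<And>l. spectral_mat U l *v x = of_real (l i) *s x"
proof -
  let ?x = "U *v axis i 1"
  have 1: "conj_transpose U *v ?x = axis i 1"
    by (simp add: matrix_vector_mul_assoc unitary_cancel[OF assms])
  have q: "quad_form (spectral_mat U l) ?x = l i" for l
    unfolding quad_form_spectral_mat 1 by (simp add: axis_def if_distrib if_distribR cong: if_cong)
  have "diag_mat l *v axis i 1 = of_real (l i) *s axis i 1" for l :: "'n \<Rightarrow> real"
    by (simp add: vec_eq_iff axis_def)
  then have e: "spectral_mat U l *v ?x = of_real (l i) *s ?x" for l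
    by (simp add: spectral_mat_def matrix_vector_mul_assoc[symmetric] 1 matrix_vector_mult_scale)
  have "(norm ?x)\<^sup>2 = 1" using q[of "\<lambda>_. 1"] by (simp add: spectral_mat_const[OF assms] quad_form_linear)
  then have "norm ?x = 1" using norm_ge_zero[of ?x] by (auto simp: power2_eq_1_iff)
  moreover from this have "?x \<noteq> 0" by (metis norm_zero zero_neq_one)
  ultimately show ?thesis using q e by (rule that)
qed

definition pd_mat :: "complex ^ 'n ^ 'n \<Rightarrow> bool" where
  "pd_mat A \<longleftrightarrow> hermitian_mat A \<and> (\<forall>x. x \<noteq> 0 \<longrightarrow> 0 < quad_form A x)"

lemma psd_mat_spectral_mat:
  assumes "unitary_mat U" shows "psd_mat (spectral_mat U l) \<longleftrightarrow> (\<forall>i. 0 \<le> l i)"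
proof
  assume a: "psd_mat (spectral_mat U l)"
  show "\<forall>i. 0 \<le> l i"
  proof
    fix i
    show "0 \<le> l i" using a quad_form_eigenvector[OF assms, of i] by (metis psd_mat_alt)
  qed
qed (simp add: psd_mat_alt quad_form_spectral_mat sum_nonneg)

text \<open>The smallest eigenvalue is such an \<open>m\<close>. The uniform bound is what makes
  positive definiteness stable under small perturbations.\<close>

lemma pd_mat_lower_bound:
  assumes "pd_mat A"
  obtains m where "m > 0" "\<And>x. m * (norm x)\<^sup>2 \<le> quad_form A x"
proof -
  obtain U l where U: "unitary_mat U" and A: "A = spectral_mat U l"
    using hermitian_spectral assms pd_mat_def by blast
  have pos: "0 < l i" for i using assms quad_form_eigenvector[OF U, of i] by (metis A pd_mat_def)
  define m where "m = Min (range l)"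
  have m: "m \<le> l i" for i by (simp add: m_def)
  have "m > 0" using pos by (simp add: m_def)
  moreover have "m * (norm x)\<^sup>2 \<le> quad_form A x" for x
    unfolding norm_unitary[OF U, symmetric] A quad_form_spectral_mat sum_distrib_left
    by (intro sum_mono mult_right_mono m) auto
  ultimately show ?thesis using that by blast
qed

lemma pd_matI: "hermitian_mat A \<Longrightarrow> 0 < m \<Longrightarrow> (\<And>x. m * (norm x)\<^sup>2 \<le> quad_form A x) \<Longrightarrow> pd_mat A"
  unfolding pd_mat_def by (metis less_le_trans mult_pos_pos zero_less_norm_iff zero_less_power)

lemma pd_mat_spectral_mat:
  assumes "unitary_mat U" shows "pd_mat (spectral_mat U l) \<longleftrightarrow> (\<forall>i. 0 < l i)"
proof
  assume a: "pd_mat (spectral_mat U l)"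
  show "\<forall>i. 0 < l i"
  proof
    fix i
    show "0 < l i" using a quad_form_eigenvector[OF assms, of i] by (metis pd_mat_def)
  qed
next
  assume a: "\<forall>i. 0 < l i"
  have "Min (range l) * (norm x)\<^sup>2 \<le> quad_form (spectral_mat U l) x" for x
    unfolding norm_unitary[OF assms, symmetric] quad_form_spectral_mat sum_distrib_left
    by (intro sum_mono mult_right_mono) auto
  then show "pd_mat (spectral_mat U l)" using a by (intro pd_matI[of _ "Min (range l)"]) auto
qed

lemma pd_mat_imp_psd_mat: "pd_mat A \<Longrightarrow> psd_mat A"
  unfolding pd_mat_def psd_mat_alt quad_form_inner
  by (metis inner_zero_left less_eq_real_def)

lemma pd_spectral:
  assumes "pd_mat A"
  obtains U l where "unitary_mat U" "A = spectral_mat U l" "\<And>i. 0 < l i"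
  using hermitian_spectral assms pd_mat_spectral_mat unfolding pd_mat_def by metis

lemma pd_mat_mat_exp: "hermitian_mat K \<Longrightarrow> pd_mat (mat_exp K)"
  by (metis exp_gt_zero hermitian_spectral mat_exp_spectral_mat pd_mat_spectral_mat)

lemma hermitian_mat_log: "pd_mat A \<Longrightarrow> hermitian_mat (mat_log A)"
  by (metis hermitian_spectral_mat mat_log_spectral_mat pd_spectral)

lemma pd_mat_add: "pd_mat A \<Longrightarrow> pd_mat B \<Longrightarrow> pd_mat (A + B)"
  by (auto simp: pd_mat_def quad_form_linear hermitian_mat_linear add_pos_pos)

lemma pd_mat_scaleR: "pd_mat A \<Longrightarrow> c > 0 \<Longrightarrow> pd_mat (c *\<^sub>R A)"
  by (auto simp: pd_mat_def quad_form_linear hermitian_mat_linear)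

lemma mat_log_scaleR:
  assumes "pd_mat A" "c > 0"
  shows "mat_log (c *\<^sub>R A) = ln c *\<^sub>R mat 1 + mat_log A"
proof -
  obtain U l where U: "unitary_mat U" "A = spectral_mat U l" "\<And>i. 0 < l i" using pd_spectral[OF assms(1)] by blast
  then show ?thesis using assms(2)
    by (simp add: mat_log_spectral_mat spectral_mat_linear spectral_mat_const[symmetric] ln_mult_pos)
qed

section \<open>Traces in spectral coordinates\<close>

definition re_trace :: "complex ^ 'n ^ 'n \<Rightarrow> real" where
  "re_trace A = Re (trace A)"

lemma re_trace_linear:
  "re_trace (A + B) = re_trace A + re_trace B"
  "re_trace (A - B) = re_trace A - re_trace B"
  "re_trace (c *\<^sub>R A) = c * re_trace A"
  by (simp_all add: re_trace_def trace_def sum.distrib sum_subtractf sum_distrib_left)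

lemma re_trace_spectral_mat:
  assumes "unitary_mat U" shows "re_trace (spectral_mat U l) = (\<Sum>i\<in>UNIV. l i)"
proof -
  have "trace (spectral_mat U l) = trace (conj_transpose U ** (U ** diag_mat l))"
    unfolding spectral_mat_def by (rule trace_mul_sym)
  then show ?thesis by (simp add: unitary_cancel[OF assms] re_trace_def trace_def diag_mat_def)
qed

lemma re_trace_spectral_mult:
  "re_trace (spectral_mat U l ** spectral_mat W m)
    = (\<Sum>i\<in>UNIV. \<Sum>j\<in>UNIV. (cmod ((conj_transpose U ** W) $ i $ j))\<^sup>2 * (l i * m j))"
proof -
  let ?C = "conj_transpose U ** W"
  have C: "conj_transpose ?C = conj_transpose W ** U" by (simp add: conj_transpose_mult)
  have "trace (spectral_mat U l ** spectral_mat W m)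
      = trace ((U ** (diag_mat l ** ?C ** diag_mat m)) ** conj_transpose W)"
    by (simp add: spectral_mat_def matrix_mul_assoc)
  also have "\<dots> = trace (conj_transpose ?C ** (diag_mat l ** ?C ** diag_mat m))"
    unfolding C by (subst trace_mul_sym) (simp add: matrix_mul_assoc)
  also have "\<dots> = (\<Sum>j\<in>UNIV. \<Sum>i\<in>UNIV. cnj (?C $ i $ j) * (of_real (l i) * ?C $ i $ j * of_real (m j)))"
    unfolding trace_def matrix_matrix_mult_def[of "conj_transpose ?C"] by simp
  also have "\<dots> = (\<Sum>i\<in>UNIV. \<Sum>j\<in>UNIV. cnj (?C $ i $ j) * (of_real (l i) * ?C $ i $ j * of_real (m j)))"
    by (rule sum.swap)
  finally show ?thesis
    unfolding cmod_power2 by (simp add: re_trace_def power2_eq_square algebra_simps)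
qed

text \<open>Rows and columns of a unitary matrix are unit vectors. Double stochasticity allows a sum
  over the eigenvalues of either matrix to be rewritten as a double sum with common weights, so that
  inequalities can be checked pair by pair.\<close>

lemma sum_overlap:
  assumes "unitary_mat U" "unitary_mat W"
  shows "(\<Sum>j\<in>UNIV. (cmod ((conj_transpose U ** W) $ i $ j))\<^sup>2) = 1"
    "(\<Sum>i\<in>UNIV. (cmod ((conj_transpose U ** W) $ i $ j))\<^sup>2) = 1"
proof -
  let ?C = "conj_transpose U ** W"
  have *: "?C ** conj_transpose ?C = mat 1" "conj_transpose ?C ** ?C = mat 1"
    by (simp_all add: conj_transpose_mult matrix_mul_assoc[symmetric] unitary_cancel[OF assms(1)] unitary_cancel[OF assms(2)])
  have "Re ((?C ** conj_transpose ?C) $ i $ i) = 1" "Re ((conj_transpose ?C ** ?C) $ j $ j) = 1"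
    unfolding * by (simp_all add: mat_def)
  then show "(\<Sum>j\<in>UNIV. (cmod (?C $ i $ j))\<^sup>2) = 1" "(\<Sum>i\<in>UNIV. (cmod (?C $ i $ j))\<^sup>2) = 1"
    unfolding matrix_matrix_mult_def[of ?C] matrix_matrix_mult_def[of "conj_transpose ?C"] cmod_power2
    by (simp_all add: power2_eq_square)
qed

section \<open>Relative entropy and Lieb's theorem\<close>

lemma matrix_mult_diff_scaleR:
  fixes A B C :: "complex ^ 'n ^ 'n"
  shows "(A - B) ** C = A ** C - B ** C" "C ** (A - B) = C ** A - C ** B"
    "(c *\<^sub>R A) ** C = c *\<^sub>R (A ** C)" "C ** (c *\<^sub>R A) = c *\<^sub>R (C ** A)"
  by (simp_all add: vec_eq_iff matrix_matrix_mult_def left_diff_distrib right_diff_distrib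
      sum_subtractf scaleR_sum_right)

lemma matrix_mult_add:
  fixes A B C :: "complex ^ 'n ^ 'n"
  shows "(A + B) ** C = A ** C + B ** C" "C ** (A + B) = C ** A + C ** B"
  by (simp_all add: vec_eq_iff matrix_matrix_mult_def distrib_left distrib_right sum.distrib)

text \<open>These are the three terms of \<open>ent_form\<close> below, once its matrix arguments
  have been diagonalised.\<close>

lemma re_trace_gram:
  fixes Z :: "complex ^ 'n ^ 'n"
  shows "re_trace (conj_transpose Z ** Z ** diag_mat a) = (\<Sum>i\<in>UNIV. \<Sum>j\<in>UNIV. (cmod (Z $ i $ j))\<^sup>2 * a j)"
    "re_trace (conj_transpose Z ** diag_mat t ** Z) = (\<Sum>i\<in>UNIV. \<Sum>j\<in>UNIV. (cmod (Z $ i $ j))\<^sup>2 * t i)"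
    "re_trace (conj_transpose Z ** diag_mat t ** C) = (\<Sum>i\<in>UNIV. \<Sum>j\<in>UNIV. t i * Re (cnj (Z $ i $ j) * C $ i $ j))"
proof -
  have "re_trace (conj_transpose Z ** Z ** diag_mat a)
      = (\<Sum>j\<in>UNIV. \<Sum>i\<in>UNIV. (cmod (Z $ i $ j))\<^sup>2 * a j)"
    unfolding cmod_power2
    by (simp add: re_trace_def trace_def matrix_mul_assoc[symmetric] power2_eq_square algebra_simps
        sum_distrib_left matrix_matrix_mult_def[of "conj_transpose Z"])
  then show "re_trace (conj_transpose Z ** Z ** diag_mat a) = (\<Sum>i\<in>UNIV. \<Sum>j\<in>UNIV. (cmod (Z $ i $ j))\<^sup>2 * a j)"
    by (subst sum.swap) simp
  have *: "re_trace (conj_transpose Z ** diag_mat t ** C)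
      = (\<Sum>j\<in>UNIV. \<Sum>i\<in>UNIV. t i * Re (cnj (Z $ i $ j) * C $ i $ j))" for C
    by (simp add: re_trace_def trace_def matrix_mul_assoc[symmetric] algebra_simps
        matrix_matrix_mult_def[of "conj_transpose Z" "diag_mat t ** C"])
  then show 3: "re_trace (conj_transpose Z ** diag_mat t ** C)
      = (\<Sum>i\<in>UNIV. \<Sum>j\<in>UNIV. t i * Re (cnj (Z $ i $ j) * C $ i $ j))" for C
    by (subst sum.swap) simp
  show "re_trace (conj_transpose Z ** diag_mat t ** Z) = (\<Sum>i\<in>UNIV. \<Sum>j\<in>UNIV. (cmod (Z $ i $ j))\<^sup>2 * t i)"
    unfolding 3 cmod_power2 by (simp add: power2_eq_square mult.commute)
qed

definition overlap :: "complex ^ 'n ^ 'n \<Rightarrow> complex ^ 'n ^ 'n \<Rightarrow> 'n \<Rightarrow> 'n \<Rightarrow> real" where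
  "overlap U W i j = (cmod ((conj_transpose U ** W) $ i $ j))\<^sup>2"

text \<open>
  The maximum over \<open>Z\<close> is \<open>\<langle>T, (R\<^sub>A + s L\<^sub>T)\<inverse> T\<rangle>\<close>, with \<open>L\<^sub>T\<close>
  and \<open>R\<^sub>A\<close> the left and right multiplications.
\<close>

definition ent_form :: "real \<Rightarrow> complex ^ 'n ^ 'n \<Rightarrow> complex ^ 'n ^ 'n \<Rightarrow> complex ^ 'n ^ 'n \<Rightarrow> real" where
  "ent_form s Z T A = 2 * re_trace (conj_transpose Z ** T) - re_trace (conj_transpose Z ** Z ** A)
     - s * re_trace (conj_transpose Z ** T ** Z)"

lemma ent_form_add: "ent_form s Z (T + T') (A + A') = ent_form s Z T A + ent_form s Z T' A'"
  by (simp add: ent_form_def matrix_mult_add re_trace_linear algebra_simps)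

lemma re_trace_gram_nonneg:
  assumes "psd_mat K" shows "0 \<le> re_trace (conj_transpose Z ** Z ** K)"
proof -
  obtain U k where U: "unitary_mat U" and K: "K = spectral_mat U k"
    using hermitian_spectral assms psd_mat_alt by blast
  then have k: "0 \<le> k i" for i using assms psd_mat_spectral_mat by blast
  have "trace (conj_transpose Z ** Z ** K) = trace ((conj_transpose Z ** Z ** U ** diag_mat k) ** conj_transpose U)"
    by (simp add: K spectral_mat_def matrix_mul_assoc)
  also have "\<dots> = trace (conj_transpose (Z ** U) ** (Z ** U) ** diag_mat k)"
    by (subst trace_mul_sym) (simp add: matrix_mul_assoc conj_transpose_mult)
  finally have "re_trace (conj_transpose Z ** Z ** K) = re_trace (conj_transpose (Z ** U) ** (Z ** U) ** diag_mat k)"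
    by (simp add: re_trace_def)
  then show ?thesis by (simp add: re_trace_gram k sum_nonneg)
qed

text \<open>\<open>A\<close> enters only through the middle term, which is subtracted. This is the
  source of antitonicity in the second argument of the relative entropy.\<close>

lemma ent_form_mono:
  assumes "psd_mat (B - A)" shows "ent_form s Z T B \<le> ent_form s Z T A"
  using re_trace_gram_nonneg[OF assms, of Z] by (simp add: ent_form_def matrix_mult_diff_scaleR re_trace_linear)

text \<open>Writing \<open>Z\<close> in the eigenbasis of \<open>T\<close> on the left and of
  \<open>A\<close> on the right decouples the form: each entry of \<open>z\<close> occurs in its own
  scalar quadratic.\<close>

lemma ent_form_spectral:
  assumes U: "unitary_mat U" and W: "unitary_mat W"
  shows "ent_form s (U ** z ** conj_transpose W) (spectral_mat U t) (spectral_mat W a) =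
    (\<Sum>i\<in>UNIV. \<Sum>j\<in>UNIV. 2 * t i * Re (cnj (z $ i $ j) * (conj_transpose U ** W) $ i $ j)
       - (cmod (z $ i $ j))\<^sup>2 * (a j + s * t i))"
proof -
  let ?Z = "U ** z ** conj_transpose W"
  let ?C = "conj_transpose U ** W"
  note simps = spectral_mat_def conj_transpose_mult matrix_mul_assoc[symmetric]
      unitary_cancel[OF U] unitary_cancel[OF W]
  have "trace (conj_transpose ?Z ** spectral_mat U t) = trace (W ** (conj_transpose z ** diag_mat t ** conj_transpose U))"
    by (simp add: simps)
  also have "\<dots> = trace (conj_transpose z ** diag_mat t ** ?C)"
    by (subst trace_mul_sym) (simp add: simps)
  finally have 1: "re_trace (conj_transpose ?Z ** spectral_mat U t) = re_trace (conj_transpose z ** diag_mat t ** ?C)"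
    by (simp add: re_trace_def)
  have "trace (conj_transpose ?Z ** ?Z ** spectral_mat W a) = trace (W ** (conj_transpose z ** z ** diag_mat a ** conj_transpose W))"
    by (simp add: simps)
  also have "\<dots> = trace (conj_transpose z ** z ** diag_mat a)"
    by (subst trace_mul_sym) (simp add: simps)
  finally have 2: "re_trace (conj_transpose ?Z ** ?Z ** spectral_mat W a) = re_trace (conj_transpose z ** z ** diag_mat a)"
    by (simp add: re_trace_def)
  have "trace (conj_transpose ?Z ** spectral_mat U t ** ?Z) = trace (W ** (conj_transpose z ** diag_mat t ** z ** conj_transpose W))"
    by (simp add: simps)
  also have "\<dots> = trace (conj_transpose z ** diag_mat t ** z)"
    by (subst trace_mul_sym) (simp add: simps)
  finally have 3: "re_trace (conj_transpose ?Z ** spectral_mat U t ** ?Z) = re_trace (conj_transpose z ** diag_mat t ** z)"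
    by (simp add: re_trace_def)
  show ?thesis
    unfolding ent_form_def 1 2 3 re_trace_gram sum_distrib_left sum_subtractf[symmetric]
    by (intro sum.cong refl) (simp add: algebra_simps)
qed

text \<open>Completing the square entrywise.\<close>

lemma ent_form_maximum:
  assumes U: "unitary_mat U" and W: "unitary_mat W"
    and t: "\<And>i. 0 < t i" and a: "\<And>j. 0 < a j" and s: "0 \<le> s"
  defines "q \<equiv> \<Sum>i\<in>UNIV. \<Sum>j\<in>UNIV. overlap U W i j * ((t i)\<^sup>2 / (a j + s * t i))"
  shows "ent_form s Z (spectral_mat U t) (spectral_mat W a) \<le> q"
    "\<exists>Z. ent_form s Z (spectral_mat U t) (spectral_mat W a) = q"
proof -
  let ?C = "conj_transpose U ** W"
  have pos: "0 < a j + s * t i" for i j using t a s by (simp add: add_pos_nonneg less_imp_le)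
  have eq: "2 * r * Re (cnj z * c) - (cmod z)\<^sup>2 * m
      = (cmod c)\<^sup>2 * (r\<^sup>2 / m) - m * (cmod (z - of_real (r / m) * c))\<^sup>2" if "m > 0" for r m :: real and z c
    using that unfolding cmod_power2 by (simp add: field_simps power2_eq_square)
  have le: "2 * r * Re (cnj z * c) - (cmod z)\<^sup>2 * m \<le> (cmod c)\<^sup>2 * (r\<^sup>2 / m)" if "m > 0" for r m :: real and z c
    unfolding eq[OF that] using that by simp
  define z where "z = conj_transpose U ** Z ** W"
  have "Z = U ** z ** conj_transpose W"
    by (simp add: z_def matrix_mul_assoc[symmetric] unitary_cancel[OF U] unitary_cancel[OF W])
  then have "ent_form s Z (spectral_mat U t) (spectral_mat W a)
      = ent_form s (U ** z ** conj_transpose W) (spectral_mat U t) (spectral_mat W a)" by (rule arg_cong)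
  also have "\<dots> \<le> q"
    unfolding q_def overlap_def ent_form_spectral[OF U W] by (intro sum_mono le pos)
  finally show "ent_form s Z (spectral_mat U t) (spectral_mat W a) \<le> q" .
  \<comment> \<open>The matrix in the middle has the entries at which all squares in
    \<open>eq\<close> vanish.\<close>
  have "ent_form s (U ** (\<chi> i j. of_real (t i / (a j + s * t i)) * ?C $ i $ j) ** conj_transpose W)
      (spectral_mat U t) (spectral_mat W a) = q"
    unfolding q_def overlap_def ent_form_spectral[OF U W] eq[OF pos] vec_lambda_beta by simp
  then show "\<exists>Z. ent_form s Z (spectral_mat U t) (spectral_mat W a) = q" ..
qed

section \<open>Relative entropy\<close>

definition rel_ent :: "complex ^ 'n ^ 'n \<Rightarrow> complex ^ 'n ^ 'n \<Rightarrow> real" where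
  "rel_ent T A = re_trace (T ** mat_log T) - re_trace (T ** mat_log A)"

lemma re_trace_overlap:
  assumes "unitary_mat U" "unitary_mat W"
  shows "re_trace (spectral_mat U t) = (\<Sum>i\<in>UNIV. \<Sum>j\<in>UNIV. overlap U W i j * t i)"
    "re_trace (spectral_mat W a) = (\<Sum>i\<in>UNIV. \<Sum>j\<in>UNIV. overlap U W i j * a j)"
proof -
  show "re_trace (spectral_mat U t) = (\<Sum>i\<in>UNIV. \<Sum>j\<in>UNIV. overlap U W i j * t i)"
    by (simp add: re_trace_spectral_mat assms overlap_def sum_distrib_right[symmetric] sum_overlap[OF assms])
  have "(\<Sum>i\<in>UNIV. \<Sum>j\<in>UNIV. overlap U W i j * a j) = (\<Sum>j\<in>UNIV. \<Sum>i\<in>UNIV. overlap U W i j * a j)"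
    by (rule sum.swap)
  then show "re_trace (spectral_mat W a) = (\<Sum>i\<in>UNIV. \<Sum>j\<in>UNIV. overlap U W i j * a j)"
    by (simp add: re_trace_spectral_mat assms overlap_def sum_distrib_right[symmetric] sum_overlap[OF assms])
qed

lemma rel_ent_spectral:
  assumes U: "unitary_mat U" and W: "unitary_mat W" and t: "\<And>i. 0 < t i" and a: "\<And>j. 0 < a j"
  shows "rel_ent (spectral_mat U t) (spectral_mat W a)
    = (\<Sum>i\<in>UNIV. \<Sum>j\<in>UNIV. overlap U W i j * (t i * (ln (t i) - ln (a j))))"
proof -
  have "re_trace (spectral_mat U t ** mat_log (spectral_mat U t))
      = (\<Sum>i\<in>UNIV. \<Sum>j\<in>UNIV. overlap U W i j * (t i * ln (t i)))"
    by (simp add: mat_log_spectral_mat U t spectral_mat_mult re_trace_overlap(1)[OF U W])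
  moreover have "re_trace (spectral_mat U t ** mat_log (spectral_mat W a))
      = (\<Sum>i\<in>UNIV. \<Sum>j\<in>UNIV. overlap U W i j * (t i * ln (a j)))"
    by (simp add: mat_log_spectral_mat W a re_trace_spectral_mult overlap_def)
  ultimately show ?thesis
    by (simp add: rel_ent_def sum_subtractf[symmetric] algebra_simps)
qed

text \<open>The tangent-line bound for ln, averaged over pairs of eigenvalues. It yields both the
  variational formula for \<open>lieb\<close> and the monotonicity of the trace exponential.\<close>

lemma klein_inequality:
  assumes "pd_mat T" "pd_mat A"
  shows "re_trace T - re_trace A \<le> rel_ent T A"
proof -
  obtain U t where U: "unitary_mat U" "T = spectral_mat U t" and t: "\<And>i. 0 < t i"
    using pd_spectral[OF assms(1)] by blast
  obtain W a where W: "unitary_mat W" "A = spectral_mat W a" and a: "\<And>i. 0 < a i"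
    using pd_spectral[OF assms(2)] by blast
  have "x - y \<le> x * (ln x - ln y)" if "0 < x" "0 < y" for x y :: real
  proof -
    have "ln (y / x) \<le> y / x - 1" using that by (intro ln_le_minus_one) simp
    then have "x * (ln y - ln x) \<le> x * (y / x - 1)" using that by (intro mult_left_mono) (auto simp: ln_div)
    then show ?thesis using that by (simp add: algebra_simps)
  qed
  then show ?thesis
    unfolding U(2) W(2) rel_ent_spectral[OF U(1) W(1) t a] re_trace_overlap[OF U(1) W(1)] sum_subtractf[symmetric]
      right_diff_distrib[symmetric]
    by (intro sum_mono mult_left_mono) (auto simp: overlap_def t a)
qed

text \<open>
  Integrating \<open>x\<^sup>2 / (y + s x) - x / (1 + s)\<close> over \<open>s \<ge> 0\<close> yields \<open>x (ln x - ln y)\<close>;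
  \<open>p\<close> is the primitive of the first term, summed over the pairs of eigenvalues.
\<close>

lemma rel_ent_integral:
  assumes "pd_mat T" "pd_mat A"
  obtains p q :: "real \<Rightarrow> real" where "p 0 = 0"
    "\<And>s. 0 \<le> s \<Longrightarrow> (p has_real_derivative q s) (at s)"
    "\<And>s Z. 0 \<le> s \<Longrightarrow> ent_form s Z T A \<le> q s"
    "\<And>s. 0 \<le> s \<Longrightarrow> \<exists>Z. ent_form s Z T A = q s"
    "((\<lambda>s. p s - re_trace T * ln s) \<longlongrightarrow> rel_ent T A) at_top"
proof -
  obtain U t where U: "unitary_mat U" "T = spectral_mat U t" and t: "\<And>i. 0 < t i"
    using pd_spectral[OF assms(1)] by blast
  obtain W a where W: "unitary_mat W" "A = spectral_mat W a" and a: "\<And>i. 0 < a i"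
    using pd_spectral[OF assms(2)] by blast
  define q where "q s = (\<Sum>i\<in>UNIV. \<Sum>j\<in>UNIV. overlap U W i j * ((t i)\<^sup>2 / (a j + s * t i)))" for s
  define p where "p s = (\<Sum>i\<in>UNIV. \<Sum>j\<in>UNIV. overlap U W i j * (t i * (ln (a j + s * t i) - ln (a j))))" for s
  show thesis
  proof (rule that[of p q])
    show "p 0 = 0" by (simp add: p_def)
    show "(p has_real_derivative q s) (at s)" if "0 \<le> s" for s
    proof -
      have "0 < a j + s * t i" for i j using t a that by (simp add: add_pos_nonneg less_imp_le)
      then show ?thesis unfolding p_def q_def
        by (auto intro!: derivative_eq_intros sum.cong simp: power2_eq_square)
    qed
    show "ent_form s Z T A \<le> q s" if "0 \<le> s" for s Z
      unfolding q_def U(2) W(2) by (rule ent_form_maximum[OF U(1) W(1) t a that])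
    show "\<exists>Z. ent_form s Z T A = q s" if "0 \<le> s" for s
      unfolding q_def U(2) W(2) by (rule ent_form_maximum[OF U(1) W(1) t a that])
    \<comment> \<open>Since ln (y + s x) = ln s + ln (y / s + x), subtracting x ln s removes exactly
      the logarithmic divergence of the primitive.\<close>
    have "((\<lambda>s. x * (ln (y + s * x) - ln y) - x * ln s) \<longlongrightarrow> x * (ln x - ln y)) at_top"
      if "0 < x" "0 < y" for x y :: real
    proof -
      have "((\<lambda>s. x * (ln (y / s + x) - ln y)) \<longlongrightarrow> x * (ln (0 + x) - ln y)) at_top"
        using that by (intro tendsto_intros real_tendsto_divide_at_top[OF tendsto_const] filterlim_ident) auto
      moreover have "eventually (\<lambda>s. x * (ln (y / s + x) - ln y) = x * (ln (y + s * x) - ln y) - x * ln s) at_top"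
        using eventually_gt_at_top[of 0]
      proof eventually_elim
        case (elim s)
        have "y / s + x = (y + s * x) / s" using elim by (simp add: field_simps)
        moreover have "0 < y + s * x" using that elim by (simp add: add_pos_pos)
        ultimately show ?case using elim by (simp add: ln_div algebra_simps)
      qed
      ultimately show ?thesis by (simp add: tendsto_cong)
    qed
    note lim = this
    have "((\<lambda>s. \<Sum>i\<in>UNIV. \<Sum>j\<in>UNIV. overlap U W i j * (t i * (ln (a j + s * t i) - ln (a j)) - t i * ln s))
        \<longlongrightarrow> (\<Sum>i\<in>UNIV. \<Sum>j\<in>UNIV. overlap U W i j * (t i * (ln (t i) - ln (a j))))) at_top"
      by (intro tendsto_sum tendsto_mult[OF tendsto_const] lim t a)
    then show "((\<lambda>s. p s - re_trace T * ln s) \<longlongrightarrow> rel_ent T A) at_top"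
      unfolding U(2) W(2) rel_ent_spectral[OF U(1) W(1) t a] re_trace_overlap(1)[OF U(1) W(1)] p_def
        sum_distrib_right sum_subtractf[symmetric]
      by (simp add: algebra_simps)
  qed
qed

text \<open>Primitives are compared instead of improper integrals: they agree at 0, their
  derivatives are ordered, and the subtracted logarithms cancel because the trace is additive.
  Allowing \<open>B\<close> above \<open>A + A'\<close> covers antitonicity in the same
  argument.\<close>

lemma rel_ent_subadditive:
  assumes T: "pd_mat T" "pd_mat T'" and A: "pd_mat A" "pd_mat A'" and B: "pd_mat B" and le: "psd_mat (B - (A + A'))"
  shows "rel_ent (T + T') B \<le> rel_ent T A + rel_ent T' A'"
proof -
  obtain p q where 1: "p 0 = 0" "\<And>s. 0 \<le> s \<Longrightarrow> (p has_real_derivative q s) (at s)"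
    "\<And>s Z. 0 \<le> s \<Longrightarrow> ent_form s Z T A \<le> q s"
    "((\<lambda>s. p s - re_trace T * ln s) \<longlongrightarrow> rel_ent T A) at_top"
    by (rule rel_ent_integral[OF T(1) A(1)]) blast
  obtain p' q' where 2: "p' 0 = 0" "\<And>s. 0 \<le> s \<Longrightarrow> (p' has_real_derivative q' s) (at s)"
    "\<And>s Z. 0 \<le> s \<Longrightarrow> ent_form s Z T' A' \<le> q' s"
    "((\<lambda>s. p' s - re_trace T' * ln s) \<longlongrightarrow> rel_ent T' A') at_top"
    by (rule rel_ent_integral[OF T(2) A(2)]) blast
  obtain r u where 3: "r 0 = 0" "\<And>s. 0 \<le> s \<Longrightarrow> (r has_real_derivative u s) (at s)"
    "\<And>s. 0 \<le> s \<Longrightarrow> \<exists>Z. ent_form s Z (T + T') B = u s"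
    "((\<lambda>s. r s - re_trace (T + T') * ln s) \<longlongrightarrow> rel_ent (T + T') B) at_top"
    by (rule rel_ent_integral[OF pd_mat_add[OF T] B]) blast
  have u: "u s \<le> q s + q' s" if s: "0 \<le> s" for s
  proof -
    obtain Z where "ent_form s Z (T + T') B = u s" using 3(3)[OF s] by blast
    then have "u s = ent_form s Z (T + T') B" by simp
    also have "\<dots> \<le> ent_form s Z (T + T') (A + A')" by (rule ent_form_mono[OF le])
    also have "\<dots> \<le> q s + q' s" unfolding ent_form_add by (intro add_mono 1(3) 2(3) s)
    finally show ?thesis .
  qed
  have "r s \<le> p s + p' s" if "0 \<le> s" for s
  proof -
    have "p 0 + p' 0 - r 0 \<le> p s + p' s - r s"
    proof (rule DERIV_nonneg_imp_nondecreasing[OF that])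
      fix x assume "0 \<le> x" "x \<le> s"
      then show "\<exists>y. ((\<lambda>s. p s + p' s - r s) has_real_derivative y) (at x) \<and> 0 \<le> y"
        using u[of x]
        by (intro exI[of _ "q x + q' x - u x"] conjI DERIV_diff DERIV_add 1(2) 2(2) 3(2)) simp_all
    qed
    then show ?thesis using 1(1) 2(1) 3(1) by simp
  qed
  then have "eventually (\<lambda>s. r s - re_trace (T + T') * ln s
      \<le> (p s - re_trace T * ln s) + (p' s - re_trace T' * ln s)) at_top"
    by (intro eventually_mono[OF eventually_ge_at_top[of 0]]) (simp add: re_trace_linear distrib_right)
  then show ?thesis
    by (rule tendsto_le[OF trivial_limit_at_top_linorder tendsto_add[OF 1(4) 2(4)] 3(4)])
qed

lemma rel_ent_scaleR:
  assumes "pd_mat T" "pd_mat A" "c > 0"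
  shows "rel_ent (c *\<^sub>R T) (c *\<^sub>R A) = c * rel_ent T A"
  using assms by (simp add: rel_ent_def mat_log_scaleR matrix_mult_add matrix_mult_diff_scaleR re_trace_linear algebra_simps)

text \<open>Halving \<open>T\<close> and \<open>A\<close> makes this an instance of
  \<open>rel_ent_subadditive\<close>; homogeneity puts the halves together again.\<close>

lemma rel_ent_antimono:
  assumes T: "pd_mat T" and A: "pd_mat A" and B: "pd_mat B" and le: "psd_mat (B - A)"
  shows "rel_ent T B \<le> rel_ent T A"
proof -
  have half: "(1/2) *\<^sub>R X + (1/2) *\<^sub>R X = X" for X :: "complex ^ 'n ^ 'n"
    by (simp add: scaleR_add_left[symmetric])
  have "rel_ent T B \<le> rel_ent ((1/2) *\<^sub>R T) ((1/2) *\<^sub>R A) + rel_ent ((1/2) *\<^sub>R T) ((1/2) *\<^sub>R A)"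
    using rel_ent_subadditive[of "(1/2) *\<^sub>R T" "(1/2) *\<^sub>R T" "(1/2) *\<^sub>R A" "(1/2) *\<^sub>R A" B]
      T A B le by (simp add: pd_mat_scaleR half)
  then show ?thesis using rel_ent_scaleR[OF T A, of "1/2"] by simp
qed

section \<open>Monotonicity of the trace exponential and of the logarithm\<close>

lemma re_trace_mult_nonneg:
  assumes "psd_mat T" "psd_mat K" shows "0 \<le> re_trace (T ** K)"
proof -
  obtain U t where U: "unitary_mat U" "T = spectral_mat U t"
    using hermitian_spectral assms(1) psd_mat_alt by blast
  obtain W k where W: "unitary_mat W" "K = spectral_mat W k"
    using hermitian_spectral assms(2) psd_mat_alt by blast
  have "0 \<le> t i" "0 \<le> k i" for i using assms psd_mat_spectral_mat U W by blast+
  then show ?thesis by (simp add: U(2) W(2) re_trace_spectral_mult sum_nonneg)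
qed

text \<open>The matrix exponential is not operator monotone, but its trace is: in Klein's inequality
  for the two exponentials the logarithms give back \<open>K\<close> and \<open>L\<close>, leaving
  minus the trace of a product of two positive semidefinite matrices.\<close>

lemma re_trace_mat_exp_mono:
  assumes "hermitian_mat K" "hermitian_mat L" "psd_mat (L - K)"
  shows "re_trace (mat_exp K) \<le> re_trace (mat_exp L)"
proof -
  have "re_trace (mat_exp K) - re_trace (mat_exp L) \<le> rel_ent (mat_exp K) (mat_exp L)"
    using assms by (intro klein_inequality pd_mat_mat_exp)
  also have "\<dots> = - re_trace (mat_exp K ** (L - K))"
    using assms by (simp add: rel_ent_def mat_log_mat_exp matrix_mult_diff_scaleR re_trace_linear)
  also have "\<dots> \<le> 0"
    using re_trace_mult_nonneg[OF pd_mat_imp_psd_mat[OF pd_mat_mat_exp] assms(3)] assms(1) by simp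
  finally show ?thesis by simp
qed

text \<open>Antitonicity of the relative entropy says that tr T (log B - log A) is nonnegative for
  every positive-definite T. Taking T diagonal in an eigenbasis of the difference isolates the
  eigenvalues.\<close>

theorem mat_log_mono:
  assumes A: "pd_mat A" and B: "pd_mat B" and le: "psd_mat (B - A)"
  shows "psd_mat (mat_log B - mat_log A)"
proof -
  have h: "hermitian_mat (mat_log B - mat_log A)" using A B by (intro hermitian_mat_linear hermitian_mat_log)
  then obtain U k where U: "unitary_mat U" and K: "mat_log B - mat_log A = spectral_mat U k"
    using hermitian_spectral by blast
  have T: "0 \<le> (\<Sum>i\<in>UNIV. t i * k i)" if "\<And>i. 0 < t i" for t
  proof -
    have "rel_ent (spectral_mat U t) B \<le> rel_ent (spectral_mat U t) A"
      using that U pd_mat_spectral_mat by (intro rel_ent_antimono A B le) blast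
    then have "0 \<le> re_trace (spectral_mat U t ** (mat_log B - mat_log A))"
      by (simp add: rel_ent_def matrix_mult_diff_scaleR re_trace_linear)
    then show ?thesis by (simp add: K U spectral_mat_mult re_trace_spectral_mat)
  qed
  have "0 \<le> k i" for i
  proof (rule ccontr)
    assume k: "\<not> 0 \<le> k i"
    define c where "c = (\<Sum>j\<in>UNIV - {i}. \<bar>k j\<bar>)"
    have c: "0 \<le> c" by (simp add: c_def sum_nonneg)
    have le: "(\<Sum>j\<in>UNIV - {i}. k j) \<le> c" unfolding c_def by (intro sum_mono) auto
    \<comment> \<open>T must stay positive definite, so the other weights cannot be 0. The weight at
      \<open>i\<close> is instead so large that its term equals \<open>k i - c\<close>, which
      outweighs the others.\<close>
    let ?t = "\<lambda>j. if j = i then 1 + c / (- k i) else 1"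
    have "0 < ?t j" for j using k c by (auto intro!: add_pos_nonneg divide_nonneg_nonneg simp: not_le)
    from T[of ?t, OF this] have "0 \<le> (1 + c / (- k i)) * k i + (\<Sum>j\<in>UNIV - {i}. ?t j * k j)"
      by (subst (asm) sum.remove[of _ i]) auto
    also have "(\<Sum>j\<in>UNIV - {i}. ?t j * k j) = (\<Sum>j\<in>UNIV - {i}. k j)"
      by (intro sum.cong) auto
    also have "(1 + c / (- k i)) * k i = k i - c" using k by (simp add: field_simps)
    finally show False using le k by simp
  qed
  then show ?thesis using K U psd_mat_spectral_mat by metis
qed

section \<open>Lieb's concavity theorem\<close>

definition lieb :: "complex ^ 'n ^ 'n \<Rightarrow> complex ^ 'n ^ 'n \<Rightarrow> real" where
  "lieb H A = re_trace (mat_exp (H + mat_log A))"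

text \<open>The Gibbs variational principle: Klein's inequality against
  \<open>mat_exp (H + mat_log A)\<close>, rearranged. Taking this matrix itself for \<open>T\<close>
  gives equality in \<open>lieb_attained\<close>.\<close>

lemma lieb_variational:
  assumes H: "hermitian_mat H" and A: "pd_mat A" and T: "pd_mat T"
  shows "re_trace (T ** H) + re_trace T - rel_ent T A \<le> lieb H A"
proof -
  have h: "hermitian_mat (H + mat_log A)" using H A by (intro hermitian_mat_linear hermitian_mat_log)
  from klein_inequality[OF T pd_mat_mat_exp[OF h]] show ?thesis
    by (simp add: rel_ent_def lieb_def mat_log_mat_exp[OF h] matrix_mult_add re_trace_linear)
qed

lemma lieb_attained:
  assumes H: "hermitian_mat H" and A: "pd_mat A"
  obtains T where "pd_mat T" "re_trace (T ** H) + re_trace T - rel_ent T A = lieb H A"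
proof
  have h: "hermitian_mat (H + mat_log A)" using H A by (intro hermitian_mat_linear hermitian_mat_log)
  let ?T = "mat_exp (H + mat_log A)"
  show "pd_mat ?T" by (rule pd_mat_mat_exp[OF h])
  show "re_trace (?T ** H) + re_trace ?T - rel_ent ?T A = lieb H A"
    by (simp add: rel_ent_def lieb_def mat_log_mat_exp[OF h] matrix_mult_add re_trace_linear)
qed

text \<open>The sum of the two maximisers competes in the variational problem for
  \<open>A + A'\<close>, and the subadditive relative entropy can only improve its value.\<close>

theorem lieb_superadditive:
  assumes H: "hermitian_mat H" and A: "pd_mat A" "pd_mat A'"
  shows "lieb H A + lieb H A' \<le> lieb H (A + A')"
proof -
  obtain T where T: "pd_mat T" "re_trace (T ** H) + re_trace T - rel_ent T A = lieb H A"
    using lieb_attained[OF H A(1)] .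
  obtain T' where T': "pd_mat T'" "re_trace (T' ** H) + re_trace T' - rel_ent T' A' = lieb H A'"
    using lieb_attained[OF H A(2)] .
  have "psd_mat (A + A' - (A + A'))" by (simp add: psd_mat_alt hermitian_mat_linear quad_form_linear)
  with T(1) T'(1) A have "rel_ent (T + T') (A + A') \<le> rel_ent T A + rel_ent T' A'"
    by (intro rel_ent_subadditive pd_mat_add)
  then show ?thesis
    using lieb_variational[OF H pd_mat_add[OF A] pd_mat_add[OF T(1) T'(1)]] T(2) T'(2)
    by (simp add: matrix_mult_add re_trace_linear)
qed

lemma mat_exp_add_const:
  assumes "hermitian_mat K"
  shows "mat_exp (c *\<^sub>R mat 1 + K) = exp c *\<^sub>R mat_exp K"
proof -
  obtain U k where U: "unitary_mat U" and K: "K = spectral_mat U k"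
    using hermitian_spectral[OF assms] .
  show ?thesis unfolding K spectral_mat_const[OF U, symmetric] spectral_mat_linear mat_exp_spectral_mat[OF U]
    by (simp add: exp_add)
qed

lemma lieb_scaleR:
  assumes "hermitian_mat H" "pd_mat A" "c > 0"
  shows "lieb H (c *\<^sub>R A) = c * lieb H A"
proof -
  have "hermitian_mat (H + mat_log A)" using assms by (intro hermitian_mat_linear hermitian_mat_log)
  then have "mat_exp (ln c *\<^sub>R mat 1 + (H + mat_log A)) = c *\<^sub>R mat_exp (H + mat_log A)"
    using mat_exp_add_const[of "H + mat_log A" "ln c"] assms by simp
  then show ?thesis using assms by (simp add: lieb_def mat_log_scaleR re_trace_linear add_ac)
qed

lemma re_trace_pd_pos: "pd_mat A \<Longrightarrow> 0 < re_trace A"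
proof -
  assume "pd_mat A"
  then obtain U l where "unitary_mat U" "A = spectral_mat U l" "\<And>i. 0 < l i" using pd_spectral[OF \<open>pd_mat A\<close>] by blast
  then show ?thesis by (auto simp: re_trace_spectral_mat intro!: sum_pos)
qed

lemma lieb_pos: "hermitian_mat H \<Longrightarrow> pd_mat A \<Longrightarrow> 0 < lieb H A"
  unfolding lieb_def by (intro re_trace_pd_pos pd_mat_mat_exp hermitian_mat_linear hermitian_mat_log)

text \<open>Monotonicity in \<open>A\<close> rests on \<open>mat_log_mono\<close>, because the
  logarithm is added to \<open>H\<close> before the trace exponential is applied.\<close>

lemma lieb_mono:
  assumes "hermitian_mat H" "hermitian_mat H'" "pd_mat A" "pd_mat A'"
    "psd_mat (H' - H)" "psd_mat (A' - A)"
  shows "lieb H A \<le> lieb H' A'"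
proof -
  have "psd_mat ((H' - H) + (mat_log A' - mat_log A))"
    using mat_log_mono[of A A'] assms by (auto simp: psd_mat_alt hermitian_mat_linear quad_form_linear)
  then show ?thesis unfolding lieb_def using assms
    by (intro re_trace_mat_exp_mono hermitian_mat_linear hermitian_mat_log) (auto simp: algebra_simps)
qed

section \<open>Supporting functionals\<close>

text \<open>The rank-one matrix x x^*. It writes the quadratic form as an inner product with the
  matrix, so results on linear functionals apply to positivity and Cauchy-Schwarz bounds the
  form.\<close>

definition outer_mat :: "complex ^ 'n \<Rightarrow> complex ^ 'n ^ 'n" where
  "outer_mat x = (\<chi> i j. x $ i * cnj (x $ j))"

lemma quad_form_outer: "quad_form A x = outer_mat x \<bullet> A"
proof -
  have "quad_form A x = (\<Sum>i\<in>UNIV. \<Sum>j\<in>UNIV. Re (cnj (x $ i) * (A $ i $ j * x $ j)))"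
    by (simp only: quad_form_def matrix_vector_mult_def vec_lambda_beta sum_distrib_left Re_sum)
  also have "\<dots> = outer_mat x \<bullet> A"
    unfolding inner_vec_def inner_complex_def outer_mat_def
    by (intro sum.cong refl) (simp add: algebra_simps)
  finally show ?thesis .
qed

lemma norm_outer_mat: "norm (outer_mat x) = (norm x)\<^sup>2"
proof -
  have "(norm (outer_mat x))\<^sup>2 = (\<Sum>i\<in>UNIV. \<Sum>j\<in>UNIV. (cmod (x $ i))\<^sup>2 * (cmod (x $ j))\<^sup>2)"
    by (simp add: outer_mat_def norm_vec_def L2_set_def sum_nonneg norm_mult power_mult_distrib)
  also have "\<dots> = ((norm x)\<^sup>2)\<^sup>2"
    by (simp add: norm_vec_def L2_set_def sum_nonneg power2_eq_square sum_product)
  finally show ?thesis by (subst (asm) power2_eq_iff_nonneg) auto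
qed

lemma abs_quad_form_le: "\<bar>quad_form A x\<bar> \<le> norm A * (norm x)\<^sup>2"
  using Cauchy_Schwarz_ineq2[of "outer_mat x" A] by (simp add: quad_form_outer norm_outer_mat mult.commute)

lemma psd_mat_norm_diff:
  assumes "hermitian_mat A" "hermitian_mat B" "norm (A - B) \<le> d"
  shows "psd_mat (B + d *\<^sub>R mat 1 - A)"
proof -
  have "quad_form (A - B) x \<le> d * (norm x)\<^sup>2" for x
    using abs_quad_form_le[of "A - B" x] mult_right_mono[OF assms(3), of "(norm x)\<^sup>2"] by simp
  then show ?thesis using assms
    by (simp add: psd_mat_alt hermitian_mat_linear quad_form_linear algebra_simps)
qed

text \<open>A perturbation small in norm costs only a factor close to 1, because the spectrum of
  \<open>B\<close> stays away from 0.\<close>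

lemma pd_mat_near:
  assumes B: "pd_mat B" and e: "0 < e"
  obtains d where "0 < d" "\<And>B'. hermitian_mat B' \<Longrightarrow> norm (B' - B) < d \<Longrightarrow> psd_mat (exp e *\<^sub>R B' - B)"
proof -
  obtain m where m: "m > 0" "\<And>x. m * (norm x)\<^sup>2 \<le> quad_form B x" using pd_mat_lower_bound[OF B] by blast
  \<comment> \<open>Write exp e B' - B as (exp e - 1) B + exp e (B' - B). The radius makes the
    second term at most (exp e - 1) m, which the first one absorbs.\<close>
  show thesis
  proof (rule that[of "(exp e - 1) * m / exp e"])
    show "0 < (exp e - 1) * m / exp e" using m e by simp
    fix B' :: "complex ^ 'a ^ 'a" assume h: "hermitian_mat B'" and n: "norm (B' - B) < (exp e - 1) * m / exp e"
    have "0 \<le> quad_form (exp e *\<^sub>R B' - B) x" for x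
    proof -
      have "exp e * \<bar>quad_form (B' - B) x\<bar> \<le> exp e * (norm (B' - B) * (norm x)\<^sup>2)"
        by (intro mult_left_mono abs_quad_form_le) simp
      also have "\<dots> \<le> exp e * ((exp e - 1) * m / exp e * (norm x)\<^sup>2)"
        using n by (intro mult_left_mono mult_right_mono) auto
      also have "\<dots> = (exp e - 1) * (m * (norm x)\<^sup>2)" by simp
      also have "\<dots> \<le> (exp e - 1) * quad_form B x"
        using m e by (intro mult_left_mono) auto
      finally have "- (exp e * quad_form (B' - B) x) \<le> (exp e - 1) * quad_form B x"
        by (smt (verit) exp_gt_zero mult_minus_right mult_left_mono)
      then show ?thesis by (simp add: quad_form_linear algebra_simps)
    qed
    then show "psd_mat (exp e *\<^sub>R B' - B)" using h B
      by (simp add: psd_mat_alt hermitian_mat_linear pd_mat_def)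
  qed
qed

text \<open>The positive-definite matrices are open among the Hermitian ones; this rules out a
  vertical supporting hyperplane in \<open>lieb_supporting_functional\<close>.\<close>

lemma pd_mat_perturb:
  assumes B: "pd_mat B" and K: "hermitian_mat K"
  obtains c where "0 < c" "pd_mat (B - c *\<^sub>R K)"
proof -
  obtain m where m: "m > 0" "\<And>x. m * (norm x)\<^sup>2 \<le> quad_form B x" using pd_mat_lower_bound[OF B] by blast
  define k where "k = norm K + 1"
  have k: "0 < k" by (simp add: k_def add_nonneg_pos)
  define c where "c = m / (2 * k)"
  have c: "0 < c" "c * norm K \<le> m / 2"
  proof -
    show "0 < c" using m k by (simp add: c_def)
    then have "c * norm K \<le> c * k" by (intro mult_left_mono) (auto simp: k_def)
    then show "c * norm K \<le> m / 2" using k by (simp add: c_def)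
  qed
  have "m / 2 * (norm x)\<^sup>2 \<le> quad_form (B - c *\<^sub>R K) x" for x
  proof -
    have "c * quad_form K x \<le> c * (norm K * (norm x)\<^sup>2)"
      using abs_quad_form_le[of K x] c by (intro mult_left_mono) auto
    also have "\<dots> \<le> m / 2 * (norm x)\<^sup>2"
      using mult_right_mono[OF c(2), of "(norm x)\<^sup>2"] by (simp add: mult.assoc)
    finally show ?thesis using m(2)[of x] by (simp add: quad_form_linear)
  qed
  then have "pd_mat (B - c *\<^sub>R K)"
    using m B K by (intro pd_matI[of _ "m / 2"] hermitian_mat_linear) (auto simp: pd_mat_def)
  then show ?thesis using c that by blast
qed

section \<open>Support and local domination of Lieb's function\<close>

lemma convex_lieb_hypograph:
  fixes H :: "complex ^ 'n ^ 'n"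
  assumes H: "hermitian_mat H"
  shows "convex {(A, r). pd_mat A \<and> r \<le> lieb H A}"
proof -
  have "pd_mat (u *\<^sub>R A + v *\<^sub>R A') \<and> u * r + v * r' \<le> lieb H (u *\<^sub>R A + v *\<^sub>R A')"
    if A: "pd_mat A" "pd_mat A'" and r: "r \<le> lieb H A" "r' \<le> lieb H A'" and uv: "0 < u" "0 < v" for A A' r r' u v
  proof -
    have "u * r + v * r' \<le> lieb H (u *\<^sub>R A) + lieb H (v *\<^sub>R A')"
      using H A r uv by (simp add: lieb_scaleR add_mono)
    also have "\<dots> \<le> lieb H (u *\<^sub>R A + v *\<^sub>R A')"
      using H A uv by (intro lieb_superadditive pd_mat_scaleR)
    finally show ?thesis using A uv by (simp add: pd_mat_add pd_mat_scaleR)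
  qed
  note comb = this
  show ?thesis unfolding convex_def
  proof (intro ballI allI impI)
    fix x y :: "(complex ^ 'n ^ 'n) \<times> real" and u v :: real
    assume xy: "x \<in> {(A, r). pd_mat A \<and> r \<le> lieb H A}" "y \<in> {(A, r). pd_mat A \<and> r \<le> lieb H A}"
      and uv: "0 \<le> u" "0 \<le> v" "u + v = 1"
    \<comment> \<open>A coefficient 0 is treated apart, since \<open>0 *\<^sub>R A\<close> leaves
      the positive-definite cone and \<open>comb\<close> scales both matrices.\<close>
    show "u *\<^sub>R x + v *\<^sub>R y \<in> {(A, r). pd_mat A \<and> r \<le> lieb H A}"
    proof (cases "u = 0 \<or> v = 0")
      case True
      then have "u *\<^sub>R x + v *\<^sub>R y = x \<or> u *\<^sub>R x + v *\<^sub>R y = y" using uv(3) by auto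
      then show ?thesis by (elim disjE) (simp_all only: xy)
    next
      case False
      then have "0 < u" "0 < v" using uv by auto
      then show ?thesis using comb[of "fst x" "fst y" "snd x" "snd y" u v] xy by (simp add: split_beta)
    qed
  qed
qed

text \<open>
  Homogeneity makes the supporting affine functional of the concave function \<open>lieb H\<close> at \<open>B\<close> linear.
\<close>

lemma lieb_supporting_functional:
  assumes H: "hermitian_mat H" and B: "pd_mat B"
  obtains G where "\<And>A. pd_mat A \<Longrightarrow> lieb H A \<le> G \<bullet> A" "G \<bullet> B = lieb H B"
proof -
  define S where "S = {(A, r). pd_mat A \<and> r \<le> lieb H A}"
  have mem: "(A, r) \<in> S \<longleftrightarrow> pd_mat A \<and> r \<le> lieb H A" for A r by (simp add: S_def)
  let ?z = "(B, lieb H B)"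
  have S: "convex S" unfolding S_def by (rule convex_lieb_hypograph[OF H])
  have zS: "?z \<in> S" "(B, lieb H B - 1) \<in> S" using B by (simp_all add: mem)
  have ne: "S \<noteq> {}" using zS(1) by blast
  \<comment> \<open>The hypograph lies over the Hermitian matrices, a proper real subspace, so the
    relative interior is the right notion. The segment from the point one unit below
    \<open>?z\<close> cannot be prolonged beyond \<open>?z\<close> inside \<open>S\<close>.\<close>
  have nz: "?z \<notin> rel_interior S"
  proof
    assume "?z \<in> rel_interior S"
    from bspec[OF this[unfolded convex_rel_interior_iff[OF S ne]] zS(2)]
    obtain e where e: "e > 1" "(1 - e) *\<^sub>R (B, lieb H B - 1) + e *\<^sub>R ?z \<in> S" by metis
    have "(1 - e) *\<^sub>R (B, lieb H B - 1) + e *\<^sub>R ?z = (B, lieb H B + (e - 1))"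
      by (simp add: scaleR_add_left[symmetric] algebra_simps)
    then show False using e by (simp add: mem)
  qed
  then obtain a where a: "\<And>y. y \<in> S \<Longrightarrow> a \<bullet> ?z \<le> a \<bullet> y" "\<And>y. y \<in> rel_interior S \<Longrightarrow> a \<bullet> ?z < a \<bullet> y"
    using supporting_hyperplane_rel_boundary[OF S zS(1) nz] by metis
  obtain G c where Gc: "a = (G, c)" by (cases a)
  have le: "G \<bullet> B + c * lieb H B \<le> G \<bullet> A + c * r" if "pd_mat A" "r \<le> lieb H A" for A r
    using a(1)[of "(A, r)"] that by (simp add: Gc mem)
  have c0: "c \<le> 0" using le[OF B, of "lieb H B - 1"] by (simp add: algebra_simps)
  \<comment> \<open>Along the ray through \<open>B\<close> the functional is proportional to k;
    minimality at k = 1, tested at k = 2 and k = 1/2, forces it to vanish.\<close>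
  have z: "G \<bullet> B + c * lieb H B = 0"
  proof -
    have "G \<bullet> B + c * lieb H B \<le> k * (G \<bullet> B + c * lieb H B)" if "k > 0" for k
      using le[OF pd_mat_scaleR[OF B that] order_refl] lieb_scaleR[OF H B that] by (simp add: algebra_simps)
    from this[of 2] this[of "1/2"] show ?thesis by simp
  qed
  \<comment> \<open>With c = 0 the functional \<open>G\<close> would be nonnegative on the cone,
    zero at \<open>B\<close> and positive at some \<open>A\<close>; stepping from \<open>B\<close> a
    little away from \<open>A\<close> stays in the cone and makes it negative.\<close>
  have c: "c < 0"
  proof (rule ccontr)
    assume "\<not> c < 0"
    then have [simp]: "c = 0" using c0 by simp
    have "rel_interior S \<noteq> {}" using rel_interior_eq_empty[OF S] ne by metis
    then obtain y where y: "y \<in> rel_interior S" by (metis equals0I)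
    obtain A r where Ar: "y = (A, r)" by (cases y)
    have "(A, r) \<in> S" using y rel_interior_subset unfolding Ar by (rule subsetD[rotated])
    then have A: "pd_mat A" by (simp add: mem)
    have pos: "0 < G \<bullet> A" using a(2)[OF y] z by (simp add: Ar Gc)
    obtain k where k: "0 < k" "pd_mat (B - k *\<^sub>R A)" using pd_mat_perturb[OF B, of A] A unfolding pd_mat_def by metis
    have "0 \<le> G \<bullet> (B - k *\<^sub>R A)" using le[OF k(2) order_refl] z by simp
    then show False using z pos k by (simp add: inner_diff_right mult_le_0_iff)
  qed
  show thesis
  proof (rule that[of "(1 / (- c)) *\<^sub>R G"])
    show "lieb H A \<le> (1 / (- c)) *\<^sub>R G \<bullet> A" if "pd_mat A" for A
      using le[OF that order_refl] z c by (simp add: field_simps)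
    show "(1 / (- c)) *\<^sub>R G \<bullet> B = lieb H B"
      using z c by (simp add: field_simps)
  qed
qed

lemma lieb_add_const:
  assumes "hermitian_mat H" "pd_mat A"
  shows "lieb (H + c *\<^sub>R mat 1) A = exp c * lieb H A"
  using mat_exp_add_const[of "H + mat_log A" c] assms
  by (simp add: lieb_def re_trace_linear hermitian_mat_linear hermitian_mat_log add_ac)

lemma lieb_local_bound:
  assumes H: "hermitian_mat H" and B: "pd_mat B" and e: "0 < e"
  obtains U G where "open U" "(H, B) \<in> U"
    "\<And>H' B' A. (H', B') \<in> U \<Longrightarrow> hermitian_mat H' \<Longrightarrow> pd_mat A \<Longrightarrow> lieb H' A \<le> G \<bullet> A"
    "\<And>H' B'. (H', B') \<in> U \<Longrightarrow> hermitian_mat H' \<Longrightarrow> pd_mat B' \<Longrightarrow> G \<bullet> B' \<le> exp e * lieb H' B'"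
proof -
  obtain G where G: "\<And>A. pd_mat A \<Longrightarrow> lieb H A \<le> G \<bullet> A" "G \<bullet> B = lieb H B"
    using lieb_supporting_functional[OF H B] by blast
  \<comment> \<open>Four factors \<open>exp d\<close> accumulate in the upper estimate: the scaling
    of \<open>G\<close>, the half-space in \<open>?V\<close>, the shift of \<open>H'\<close>, and
    the scaling of \<open>B'\<close>.\<close>
  define d where "d = e / 4"
  have d: "0 < d" using e by (simp add: d_def)
  obtain r where r: "0 < r" "\<And>B'. hermitian_mat B' \<Longrightarrow> norm (B' - B) < r \<Longrightarrow> psd_mat (exp d *\<^sub>R B' - B)"
    using pd_mat_near[OF B d] by blast
  \<comment> \<open>The ball bounds \<open>B\<close> by \<open>exp d *\<^sub>R B'\<close> in the
    semidefinite order; the half-space keeps \<open>G \<bullet> B'\<close> close to its value at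
    \<open>B\<close>.\<close>
  let ?V = "ball B r \<inter> {B'. G \<bullet> B' < exp d * lieb H B}"
  show thesis
  proof (rule that[of "ball H d \<times> ?V" "exp d *\<^sub>R G"])
    show "open (ball H d \<times> ?V)" by (intro open_Times open_Int open_ball open_halfspace_lt)
    have "1 * lieb H B < exp d * lieb H B" using d lieb_pos[OF H B] by (intro mult_strict_right_mono) auto
    then show "(H, B) \<in> ball H d \<times> ?V" using d r by (simp add: G(2))
    fix H' B' assume U: "(H', B') \<in> ball H d \<times> ?V" and H': "hermitian_mat H'"
    have n: "norm (H' - H) \<le> d" "norm (H - H') \<le> d" "norm (B' - B) < r"
      using U by (auto simp: dist_norm norm_minus_commute)
    show "lieb H' A \<le> exp d *\<^sub>R G \<bullet> A" if A: "pd_mat A" for A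
    proof -
      have "lieb H' A \<le> lieb (H + d *\<^sub>R mat 1) A"
        using psd_mat_norm_diff[OF H' H n(1)] H H' A
        by (intro lieb_mono hermitian_mat_linear) (auto simp: psd_mat_alt hermitian_mat_linear quad_form_linear)
      also have "\<dots> = exp d * lieb H A" by (rule lieb_add_const[OF H A])
      also have "\<dots> \<le> exp d * (G \<bullet> A)" by (intro mult_left_mono G A) simp
      finally show ?thesis by simp
    qed
    show "exp d *\<^sub>R G \<bullet> B' \<le> exp e * lieb H' B'" if B': "pd_mat B'"
    proof -
      have "G \<bullet> B' \<le> exp d * lieb H B" using U by simp
      also have "lieb H B \<le> lieb (H' + d *\<^sub>R mat 1) (exp d *\<^sub>R B')"
        using psd_mat_norm_diff[OF H H' n(2)] r(2)[OF _ n(3)] H H' B B'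
        by (intro lieb_mono hermitian_mat_linear pd_mat_scaleR) (auto simp: pd_mat_def)
      also have "\<dots> = exp d * (exp d * lieb H' B')"
        using H' B' by (simp add: lieb_add_const pd_mat_scaleR lieb_scaleR)
      finally have "exp d * (G \<bullet> B') \<le> exp d * (exp d * (exp d * (exp d * lieb H' B')))"
        by (simp add: mult_le_cancel_left)
      also have "\<dots> = exp (d + d + d + d) * lieb H' B'" by (simp only: exp_add mult.assoc)
      also have "d + d + d + d = e" by (simp add: d_def)
      finally show ?thesis by simp
    qed
  qed
qed

section \<open>Conditional expectation of matrices\<close>

lemma borel_measurable_mat_mult:
  fixes f g :: "'a \<Rightarrow> complex ^ 'n ^ 'n"
  assumes "f \<in> borel_measurable M" "g \<in> borel_measurable M"
  shows "(\<lambda>x. f x ** g x) \<in> borel_measurable M"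
proof -
  have "continuous_on UNIV (\<lambda>p :: (complex ^ 'n ^ 'n) \<times> (complex ^ 'n ^ 'n). fst p ** snd p)"
    unfolding matrix_matrix_mult_def by (intro continuous_intros)
  from borel_measurable_continuous_Pair[OF assms, of "(**)"] this show ?thesis by simp
qed

lemma borel_measurable_mat_exp:
  assumes "f \<in> borel_measurable M" shows "(\<lambda>x. mat_exp (f x)) \<in> borel_measurable M"
proof -
  have "(\<lambda>x. mat_pow (f x) n) \<in> borel_measurable M" for n
    by (induction n) (use assms in \<open>auto intro: borel_measurable_mat_mult\<close>)
  then show ?thesis unfolding mat_exp_def
    by (intro borel_measurable_suminf borel_measurable_scaleR borel_measurable_const)
qed

lemma borel_measurable_re_trace:
  assumes "f \<in> borel_measurable M" shows "(\<lambda>x. re_trace (f x)) \<in> borel_measurable M"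
proof -
  have "continuous_on UNIV (re_trace :: complex ^ 'n ^ 'n \<Rightarrow> real)"
    unfolding re_trace_def trace_def by (intro continuous_intros)
  then show ?thesis using assms by (rule borel_measurable_continuous_on)
qed

text \<open>A scalar lower bound that is measurable in \<open>K\<close>; it is what survives
  conditioning in \<open>mat_cond_exp_pd\<close>.\<close>

lemma mat_exp_lower_bound:
  assumes "hermitian_mat K"
  shows "exp (- norm K) * (norm x)\<^sup>2 \<le> quad_form (mat_exp K) x"
proof -
  obtain U k where U: "unitary_mat U" and K: "K = spectral_mat U k"
    using hermitian_spectral[OF assms] .
  have "- norm K \<le> k i" for i
  proof -
    obtain y where "norm y = 1" "quad_form K y = k i"
      using quad_form_eigenvector[OF U, of i] unfolding K by metis
    then show ?thesis using abs_quad_form_le[of K y] by simp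
  qed
  then show ?thesis
    unfolding norm_unitary[OF U, symmetric] quad_form_spectral_mat sum_distrib_left
    by (subst K, subst mat_exp_spectral_mat[OF U], subst quad_form_spectral_mat)
       (intro sum_mono mult_right_mono, auto)
qed

lemma inner_conj_transpose_mat: "conj_transpose A \<bullet> B = A \<bullet> conj_transpose B"
proof -
  have "conj_transpose A \<bullet> B = (\<Sum>i\<in>UNIV. \<Sum>j\<in>UNIV. cnj (A $ j $ i) \<bullet> B $ i $ j)"
    by (simp add: inner_vec_def)
  also have "\<dots> = (\<Sum>j\<in>UNIV. \<Sum>i\<in>UNIV. cnj (A $ j $ i) \<bullet> B $ i $ j)"
    by (rule sum.swap)
  also have "\<dots> = A \<bullet> conj_transpose B"
    by (simp add: inner_vec_def inner_complex_def)
  finally show ?thesis .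
qed

text \<open>The real basis consists of matrix units times 1 or \<i>, so the entrywise definition is
  conditional expectation coordinate by coordinate.\<close>

lemma mat_cond_exp_Basis:
  assumes "b \<in> Basis"
  shows "b \<bullet> mat_cond_exp M F Z x = real_cond_exp M F (\<lambda>x. b \<bullet> Z x) x"
proof -
  obtain i j c where b: "b = axis i (axis j c)" and c: "c = 1 \<or> c = \<i>"
    using assms unfolding Basis_vec_def Basis_complex_def by blast
  have e: "b \<bullet> A = (if c = 1 then Re (A $ i $ j) else Im (A $ i $ j))" for A
    using c unfolding b inner_axis' by (auto simp: inner_complex_def)
  show ?thesis unfolding e by (cases "c = 1") (simp_all add: mat_cond_exp_def)
qed

lemma borel_measurable_mat_cond_exp:
  fixes Z :: "'b \<Rightarrow> complex ^ 'a ^ 'a"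
  shows "mat_cond_exp M F Z \<in> borel_measurable F"
proof (rule iffD2[OF borel_measurable_euclidean_space], rule ballI)
  fix b :: "complex ^ 'a ^ 'a" assume b: "b \<in> Basis"
  have "mat_cond_exp M F Z x \<bullet> b = real_cond_exp M F (\<lambda>x. b \<bullet> Z x) x" for x
    by (subst inner_commute) (rule mat_cond_exp_Basis[OF b])
  then have eq: "(\<lambda>x. mat_cond_exp M F Z x \<bullet> b) = real_cond_exp M F (\<lambda>x. b \<bullet> Z x)"
    by (rule ext)
  show "(\<lambda>x. mat_cond_exp M F Z x \<bullet> b) \<in> borel_measurable F"
    unfolding eq by (rule borel_measurable_cond_exp)
qed

context finite_measure_subalgebra
begin

text \<open>
  The weight \<open>r\<close> is \<open>F\<close>-measurable and makes \<open>Z\<close> integrable, which gives access to the linearity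
  of \<open>real_cond_exp\<close>.
\<close>

lemma cond_integrable_weight:
  fixes Z :: "'a \<Rightarrow> complex ^ 'n ^ 'n"
  assumes Z: "cond_integrable M F Z"
  obtains r where "r \<in> borel_measurable F" "\<And>x. 0 < r x" "\<And>x. r x \<le> 1"
    "\<And>G. integrable M (\<lambda>x. r x * (G \<bullet> Z x))"
    "\<And>G. AE x in M. real_cond_exp M F (\<lambda>x. r x * (G \<bullet> Z x)) x = r x * (G \<bullet> mat_cond_exp M F Z x)"
proof -
  have Zm [measurable]: "Z \<in> borel_measurable M" using Z by (simp add: cond_integrable_def)
  define n where "n = nn_cond_exp M F (\<lambda>x. ennreal (norm (Z x)))"
  have fin: "AE x in M. n x < \<infinity>" using Z by (simp add: cond_integrable_def n_def)
  have nF [measurable]: "n \<in> borel_measurable F" by (simp add: n_def)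
  \<comment> \<open>The weight bounds \<open>r x * n x\<close> by 1 wherever \<open>n\<close> is
    finite. On the null set where \<open>n\<close> is infinite, \<open>enn2real\<close> gives 0 and
    r = 1, so positivity holds everywhere.\<close>
  define r where "r x = 1 / (1 + enn2real (n x))" for x
  have rF [measurable]: "r \<in> borel_measurable F" unfolding r_def by measurable
  then have rM [measurable]: "r \<in> borel_measurable M" by (rule measurable_from_subalg[OF subalg])
  have r: "0 < r x" "r x \<le> 1" for x by (auto simp: r_def divide_le_eq add_pos_nonneg)
  have "integrable M (\<lambda>x. r x * norm (Z x))"
  proof (rule integrableI_nonneg)
    have "(\<integral>\<^sup>+x. ennreal (r x * norm (Z x)) \<partial>M) = (\<integral>\<^sup>+x. ennreal (r x) * ennreal (norm (Z x)) \<partial>M)"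
      using r by (simp add: ennreal_mult' less_imp_le)
    also have "\<dots> = (\<integral>\<^sup>+x. ennreal (r x) * n x \<partial>M)"
      unfolding n_def by (rule nn_cond_exp_intg[symmetric]) measurable
    also have "\<dots> \<le> (\<integral>\<^sup>+x. 1 \<partial>M)"
    proof (rule nn_integral_mono_AE)
      show "AE x in M. ennreal (r x) * n x \<le> 1"
        using fin
      proof eventually_elim
        case (elim x)
        then obtain y where y: "n x = ennreal y" "0 \<le> y" by (cases "n x") auto
        then have "r x * y \<le> 1" by (simp add: r_def)
        then show ?case using r[of x] y by (simp add: ennreal_mult'[symmetric] ennreal_le_1)
      qed
    qed
    also have "\<dots> < \<infinity>" by (simp add: emeasure_eq_measure)
    finally show "(\<integral>\<^sup>+x. ennreal (r x * norm (Z x)) \<partial>M) < \<infinity>" .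
  qed (use r in \<open>auto simp: less_imp_le\<close>)
  then have bound: "integrable M (\<lambda>x. c * (r x * norm (Z x)))" for c
    by (rule integrable_mult_right)
  have int: "integrable M (\<lambda>x. r x * (G \<bullet> Z x))" for G
  proof (rule Bochner_Integration.integrable_bound[OF bound[of "norm G"]])
    have "\<bar>r x * (G \<bullet> Z x)\<bar> \<le> \<bar>norm G * (r x * norm (Z x))\<bar>" for x
      using mult_left_mono[OF Cauchy_Schwarz_ineq2[of G "Z x"] less_imp_le[OF r(1)[of x]]] r(1)[of x]
      by (simp add: abs_mult mult_ac)
    then show "AE x in M. norm (r x * (G \<bullet> Z x)) \<le> norm (norm G * (r x * norm (Z x)))" by simp
  qed measurable
  have cond: "AE x in M. real_cond_exp M F (\<lambda>x. r x * (G \<bullet> Z x)) x = r x * (G \<bullet> mat_cond_exp M F Z x)" for G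
  proof -
    have 1: "AE x in M. real_cond_exp M F (\<lambda>x. \<Sum>b\<in>Basis. (G \<bullet> b) * (r x * (b \<bullet> Z x))) x
        = (\<Sum>b\<in>Basis. real_cond_exp M F (\<lambda>x. (G \<bullet> b) * (r x * (b \<bullet> Z x))) x)"
      by (rule real_cond_exp_sum) (intro integrable_mult_right int)
    have 2: "AE x in M. \<forall>b\<in>Basis. real_cond_exp M F (\<lambda>x. (G \<bullet> b) * (r x * (b \<bullet> Z x))) x
        = (G \<bullet> b) * real_cond_exp M F (\<lambda>x. r x * (b \<bullet> Z x)) x"
      by (intro AE_finite_allI finite_Basis real_cond_exp_cmult int)
    have 3: "AE x in M. \<forall>b\<in>Basis. real_cond_exp M F (\<lambda>x. r x * (b \<bullet> Z x)) x
        = r x * real_cond_exp M F (\<lambda>x. b \<bullet> Z x) x"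
      by (intro AE_finite_allI finite_Basis real_cond_exp_mult int) measurable
    have eq: "r x * (G \<bullet> A) = (\<Sum>b\<in>Basis. (G \<bullet> b) * (r x * (b \<bullet> A)))" for x A
      by (subst euclidean_inner) (simp add: sum_distrib_left inner_commute mult_ac)
    show ?thesis using 1 2 3
    proof eventually_elim
      case (elim x)
      then show ?case unfolding eq by (simp add: mat_cond_exp_Basis)
    qed
  qed
  show thesis using rF r int cond by (rule that)
qed

text \<open>\<open>G \<bullet> Z x\<close> itself may fail to be integrable. The weight
  \<open>r\<close> from \<open>cond_integrable_weight\<close> repairs this, and being
  \<open>F\<close>-measurable and positive it can be divided out again under the nonnegative
  integral.\<close>

lemma mat_cond_exp_nonneg_functional:
  fixes Z :: "'a \<Rightarrow> complex ^ 'n ^ 'n"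
  assumes Z: "cond_integrable M F Z" and nn: "\<And>x. x \<in> space M \<Longrightarrow> 0 \<le> G \<bullet> Z x"
  shows "AE x in M. 0 \<le> G \<bullet> mat_cond_exp M F Z x"
    and "S \<in> sets F \<Longrightarrow> (\<integral>\<^sup>+x\<in>S. ennreal (G \<bullet> Z x) \<partial>M) = (\<integral>\<^sup>+x\<in>S. ennreal (G \<bullet> mat_cond_exp M F Z x) \<partial>M)"
proof -
  have Zm [measurable]: "Z \<in> borel_measurable M" using Z by (simp add: cond_integrable_def)
  obtain r where r [measurable]: "r \<in> borel_measurable F" and r0: "\<And>x. 0 < r x" "\<And>x. r x \<le> 1"
    and int: "\<And>G. integrable M (\<lambda>x. r x * (G \<bullet> Z x))"
    and cond: "\<And>G. AE x in M. real_cond_exp M F (\<lambda>x. r x * (G \<bullet> Z x)) x = r x * (G \<bullet> mat_cond_exp M F Z x)"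
    by (rule cond_integrable_weight[OF Z]) blast
  have rM [measurable]: "r \<in> borel_measurable M" by (rule measurable_from_subalg[OF subalg r])
  let ?f = "\<lambda>x. r x * (G \<bullet> Z x)"
  have f0: "AE x in M. 0 \<le> ?f x" using nn r0 by (auto simp: less_imp_le)
  have pos: "AE x in M. 0 \<le> real_cond_exp M F ?f x" by (rule real_cond_exp_pos[OF f0]) measurable
  then show "AE x in M. 0 \<le> G \<bullet> mat_cond_exp M F Z x"
    using cond[of G]
  proof eventually_elim
    case (elim x)
    then show ?case using r0(1)[of x] by (simp add: zero_le_mult_iff)
  qed
  \<comment> \<open>The negative part of \<open>?f\<close> vanishes and its positive part has a
    finite conditional expectation, so \<open>real_cond_exp\<close> and \<open>nn_cond_exp\<close>
    agree.\<close>
  have "AE x in M. nn_cond_exp M F (\<lambda>x. ennreal (- ?f x)) x = nn_cond_exp M F (\<lambda>_. 0) x"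
    using f0 by (intro nn_cond_exp_cong) (auto elim!: eventually_mono simp: ennreal_neg)
  moreover have "AE x in M. 0 = nn_cond_exp M F (\<lambda>_. 0) x" by (rule nn_cond_exp_F_meas) simp
  moreover have "AE x in M. nn_cond_exp M F (\<lambda>x. ennreal (?f x)) x \<noteq> \<infinity>"
  proof (rule nn_integral_PInf_AE)
    have "(\<integral>\<^sup>+x. nn_cond_exp M F (\<lambda>x. ennreal (?f x)) x \<partial>M) = (\<integral>\<^sup>+x. ennreal (?f x) \<partial>M)"
      using nn_cond_exp_intg[of "\<lambda>_. 1" "\<lambda>x. ennreal (?f x)"] by simp
    then show "(\<integral>\<^sup>+x. nn_cond_exp M F (\<lambda>x. ennreal (?f x)) x \<partial>M) \<noteq> \<infinity>"
      using integrableD(2)[OF int[of G]] by (simp add: top.not_eq_extremum real_integrable_def)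
  qed simp
  ultimately have nnc: "AE x in M. nn_cond_exp M F (\<lambda>x. ennreal (?f x)) x = ennreal (r x * (G \<bullet> mat_cond_exp M F Z x))"
    using cond[of G]
  proof eventually_elim
    case (elim x)
    then show ?case unfolding real_cond_exp_def by (cases "nn_cond_exp M F (\<lambda>x. ennreal (?f x)) x") auto
  qed
  assume S [measurable]: "S \<in> sets F"
  let ?w = "\<lambda>x. ennreal (1 / r x) * indicator S x"
  have w: "?w \<in> borel_measurable F" by measurable
  have *: "?w x * ennreal (r x * y) = ennreal y * indicator S x" for x y
  proof -
    have "ennreal (1 / r x) * ennreal (r x * y) = ennreal y"
      using r0(1)[of x] by (simp add: ennreal_mult'[symmetric])
    then show ?thesis by (simp add: indicator_def)
  qed
  have "(\<integral>\<^sup>+x\<in>S. ennreal (G \<bullet> Z x) \<partial>M) = (\<integral>\<^sup>+x. ?w x * ennreal (?f x) \<partial>M)"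
    by (simp only: *)
  also have "\<dots> = (\<integral>\<^sup>+x. ?w x * nn_cond_exp M F (\<lambda>x. ennreal (?f x)) x \<partial>M)"
    by (rule nn_cond_exp_intg[OF w, symmetric]) measurable
  also have "\<dots> = (\<integral>\<^sup>+x. ?w x * ennreal (r x * (G \<bullet> mat_cond_exp M F Z x)) \<partial>M)"
    using nnc by (intro nn_integral_cong_AE) (auto elim!: eventually_mono)
  also have "\<dots> = (\<integral>\<^sup>+x\<in>S. ennreal (G \<bullet> mat_cond_exp M F Z x) \<partial>M)"
    by (simp only: *)
  finally show "(\<integral>\<^sup>+x\<in>S. ennreal (G \<bullet> Z x) \<partial>M) = (\<integral>\<^sup>+x\<in>S. ennreal (G \<bullet> mat_cond_exp M F Z x) \<partial>M)" .
qed

text \<open>Being Hermitian means being orthogonal to every \<open>b - conj_transpose b\<close>;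
  each such equation is obtained from the nonnegative functionals of both signs.\<close>

lemma mat_cond_exp_hermitian:
  fixes Z :: "'a \<Rightarrow> complex ^ 'n ^ 'n"
  assumes Z: "cond_integrable M F Z" and h: "\<And>x. x \<in> space M \<Longrightarrow> hermitian_mat (Z x)"
  shows "AE x in M. hermitian_mat (mat_cond_exp M F Z x)"
proof -
  have z: "(b - conj_transpose b) \<bullet> Z x = 0" if "x \<in> space M" for b x
  proof -
    have "conj_transpose (Z x) = Z x" using h[OF that] unfolding hermitian_mat_def .
    then show ?thesis by (simp only: inner_diff_left inner_conj_transpose_mat diff_self)
  qed
  have "AE x in M. 0 \<le> (b - conj_transpose b) \<bullet> mat_cond_exp M F Z x" for b
    by (rule mat_cond_exp_nonneg_functional(1)[OF Z]) (simp add: z)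
  then have "AE x in M. \<forall>b\<in>Basis. 0 \<le> (b - conj_transpose b) \<bullet> mat_cond_exp M F Z x"
    by (intro AE_finite_allI[OF finite_Basis])
  moreover have "AE x in M. 0 \<le> (- (b - conj_transpose b)) \<bullet> mat_cond_exp M F Z x" for b
    by (rule mat_cond_exp_nonneg_functional(1)[OF Z]) (simp add: inner_minus_left z del: minus_diff_eq)
  then have "AE x in M. \<forall>b\<in>Basis. 0 \<le> (- (b - conj_transpose b)) \<bullet> mat_cond_exp M F Z x"
    by (intro AE_finite_allI[OF finite_Basis])
  ultimately show ?thesis
  proof eventually_elim
    case (elim x)
    let ?B = "mat_cond_exp M F Z x"
    have "conj_transpose ?B \<bullet> b = ?B \<bullet> b" if "b \<in> Basis" for b
    proof -
      have "conj_transpose ?B \<bullet> b = b \<bullet> conj_transpose ?B" by (rule inner_commute)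
      also have "\<dots> = conj_transpose b \<bullet> ?B" by (rule inner_conj_transpose_mat[symmetric])
      also have "\<dots> = b \<bullet> ?B"
        using bspec[OF elim(1) that] bspec[OF elim(2) that] by (simp add: inner_diff_left inner_minus_left)
      also have "\<dots> = ?B \<bullet> b" by (rule inner_commute)
      finally show ?thesis .
    qed
    then have "conj_transpose ?B = ?B" by (rule euclidean_eqI)
    then show ?case unfolding hermitian_mat_def .
  qed
qed

text \<open>Strict positivity comes from conditioning a positive scalar minorant: the conditional
  expectation of a positive variable is positive almost surely.\<close>

lemma mat_cond_exp_pd:
  fixes K :: "'a \<Rightarrow> complex ^ 'n ^ 'n"
  assumes Z: "cond_integrable M F (\<lambda>x. mat_exp (K x))" and K [measurable]: "K \<in> borel_measurable M"
    and h: "\<And>x. x \<in> space M \<Longrightarrow> hermitian_mat (K x)"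
  shows "AE x in M. pd_mat (mat_cond_exp M F (\<lambda>x. mat_exp (K x)) x)"
proof -
  let ?Z = "\<lambda>x. mat_exp (K x)"
  obtain r where r [measurable]: "r \<in> borel_measurable F" and r0: "\<And>x. 0 < r x" "\<And>x. r x \<le> 1"
    and int: "\<And>G. integrable M (\<lambda>x. r x * (G \<bullet> ?Z x))"
    and cond: "\<And>G. AE x in M. real_cond_exp M F (\<lambda>x. r x * (G \<bullet> ?Z x)) x = r x * (G \<bullet> mat_cond_exp M F ?Z x)"
    by (rule cond_integrable_weight[OF Z]) blast
  have rM [measurable]: "r \<in> borel_measurable M" by (rule measurable_from_subalg[OF subalg r])
  \<comment> \<open>The minorant of the weighted quadratic form on unit vectors; it is bounded by 1,
    hence integrable.\<close>
  define m where "m x = r x * exp (- norm (K x))" for x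
  have mint: "integrable M m"
  proof (rule integrable_const_bound[of _ 1])
    have "r x * exp (- norm (K x)) \<le> 1 * 1" for x using r0[of x] by (intro mult_mono) auto
    then show "AE x in M. norm (m x) \<le> 1" using r0 by (simp add: m_def less_imp_le)
  next
    show "m \<in> borel_measurable M" unfolding m_def by measurable
  qed
  have pos: "AE x in M. 0 < real_cond_exp M F m x"
    by (rule real_cond_exp_gr_c[OF mint]) (simp add: m_def r0)
  \<comment> \<open>The exceptional null set depends on the test vector, so only countably many
    vectors are tested; continuity in \<open>y\<close> extends the bound to all of them.\<close>
  obtain D :: "(complex ^ 'n) set" where D: "countable D" "\<And>X. open X \<Longrightarrow> X \<noteq> {} \<Longrightarrow> \<exists>d\<in>D. d \<in> X"
    using countable_dense_exists by blast
  have "AE x in M. (norm y)\<^sup>2 * real_cond_exp M F m x \<le> r x * quad_form (mat_cond_exp M F ?Z x) y" for y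
  proof -
    have "AE x in M. real_cond_exp M F (\<lambda>x. (norm y)\<^sup>2 * m x) x \<le> real_cond_exp M F (\<lambda>x. r x * (outer_mat y \<bullet> ?Z x)) x"
    proof (rule real_cond_exp_mono)
      show "AE x in M. (norm y)\<^sup>2 * m x \<le> r x * (outer_mat y \<bullet> ?Z x)"
      proof (rule AE_I2)
        fix x assume "x \<in> space M"
        from mult_left_mono[OF mat_exp_lower_bound[OF h[OF this], of y] less_imp_le[OF r0(1)[of x]]]
        show "(norm y)\<^sup>2 * m x \<le> r x * (outer_mat y \<bullet> ?Z x)"
          by (simp add: m_def quad_form_outer mult_ac)
      qed
    qed (intro integrable_mult_right mint int)+
    moreover have "AE x in M. real_cond_exp M F (\<lambda>x. (norm y)\<^sup>2 * m x) x = (norm y)\<^sup>2 * real_cond_exp M F m x"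
      by (rule real_cond_exp_cmult[OF mint])
    ultimately show ?thesis using cond[of "outer_mat y"]
      by eventually_elim (simp add: quad_form_outer)
  qed
  then have "AE x in M. \<forall>y\<in>D. (norm y)\<^sup>2 * real_cond_exp M F m x \<le> r x * quad_form (mat_cond_exp M F ?Z x) y"
    using D(1) by (simp add: AE_ball_countable)
  moreover have "AE x in M. hermitian_mat (mat_cond_exp M F ?Z x)"
    using pd_mat_mat_exp[OF h] by (intro mat_cond_exp_hermitian[OF Z]) (simp add: pd_mat_def)
  ultimately show ?thesis using pos
  proof eventually_elim
    case (elim x)
    let ?B = "mat_cond_exp M F ?Z x" and ?u = "real_cond_exp M F m x"
    have "(norm y)\<^sup>2 * ?u \<le> r x * quad_form ?B y" for y
    proof (rule ccontr)
      assume "\<not> ?thesis"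
      moreover have "open {y. r x * quad_form ?B y < (norm y)\<^sup>2 * ?u}"
        unfolding quad_form_inner by (intro open_Collect_less continuous_intros)
      ultimately obtain d where "d \<in> D" "r x * quad_form ?B d < (norm d)\<^sup>2 * ?u"
        using D(2)[of "{y. r x * quad_form ?B y < (norm y)\<^sup>2 * ?u}"] by (auto simp: not_le)
      then show False using elim(1) by force
    qed
    then have "?u / r x * (norm y)\<^sup>2 \<le> quad_form ?B y" for y
      using r0(1)[of x] by (simp add: field_simps)
    then show ?case using elim r0(1)[of x] by (intro pd_matI[of _ "?u / r x"]) auto
  qed
qed

end

section \<open>Supermartingale and maximal inequality\<close>

text \<open>The Lindelof property reduces the cover by the neighbourhoods of
  \<open>lieb_local_bound\<close> to a sequence, as countable additivity demands. Nonnegativity of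
  the functionals is inherited from the positivity of \<open>lieb\<close>.\<close>

lemma lieb_countable_bound:
  assumes e: "0 < e"
  obtains U :: "nat \<Rightarrow> ((complex ^ 'n ^ 'n) \<times> (complex ^ 'n ^ 'n)) set" and G where
    "\<And>n. open (U n)" "\<And>H B. hermitian_mat H \<Longrightarrow> pd_mat B \<Longrightarrow> \<exists>n. (H, B) \<in> U n"
    "\<And>n A. pd_mat A \<Longrightarrow> 0 \<le> G n \<bullet> A"
    "\<And>n H B A. (H, B) \<in> U n \<Longrightarrow> hermitian_mat H \<Longrightarrow> pd_mat A \<Longrightarrow> lieb H A \<le> G n \<bullet> A"
    "\<And>n H B. (H, B) \<in> U n \<Longrightarrow> hermitian_mat H \<Longrightarrow> pd_mat B \<Longrightarrow> G n \<bullet> B \<le> exp e * lieb H B"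
proof -
  define P where "P U G \<longleftrightarrow> open U \<and> (\<forall>A. pd_mat A \<longrightarrow> 0 \<le> G \<bullet> A)
    \<and> (\<forall>H B A. (H, B) \<in> U \<longrightarrow> hermitian_mat H \<longrightarrow> pd_mat A \<longrightarrow> lieb H A \<le> G \<bullet> A)
    \<and> (\<forall>H B. (H, B) \<in> U \<longrightarrow> hermitian_mat H \<longrightarrow> pd_mat B \<longrightarrow> G \<bullet> B \<le> exp e * lieb H B)"
    for U :: "((complex ^ 'n ^ 'n) \<times> (complex ^ 'n ^ 'n)) set" and G
  have cover: "\<exists>U G. P U G \<and> (H, B) \<in> U" if H: "hermitian_mat H" and B: "pd_mat B" for H B
  proof -
    obtain U G where U: "open U" "(H, B) \<in> U"
      "\<And>H' B' A. (H', B') \<in> U \<Longrightarrow> hermitian_mat H' \<Longrightarrow> pd_mat A \<Longrightarrow> lieb H' A \<le> G \<bullet> A"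
      "\<And>H' B'. (H', B') \<in> U \<Longrightarrow> hermitian_mat H' \<Longrightarrow> pd_mat B' \<Longrightarrow> G \<bullet> B' \<le> exp e * lieb H' B'"
      by (rule lieb_local_bound[OF H B e]) blast
    have "0 \<le> G \<bullet> A" if "pd_mat A" for A
      using U(3)[OF U(2) H that] lieb_pos[OF H that] by simp
    with U have "P U G" unfolding P_def by blast
    with U(2) show ?thesis by blast
  qed
  obtain C where C: "C \<subseteq> {U. \<exists>G. P U G}" "countable C" "\<Union>C = \<Union>{U. \<exists>G. P U G}"
    by (rule Lindelof[of "{U. \<exists>G. P U G}"]) (auto simp: P_def)
  have in_C: "\<exists>U\<in>C. (H, B) \<in> U" if "hermitian_mat H" "pd_mat B" for H B
    using cover[OF that] C(3) by blast
  have "pd_mat (mat 1 :: complex ^ 'n ^ 'n)"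
    by (rule pd_matI[of _ 1]) (auto simp: hermitian_mat_linear quad_form_linear)
  then have ne: "C \<noteq> {}" using in_C[OF hermitian_mat_linear(4)] by blast
  define U where "U = from_nat_into C"
  define G where "G n = (SOME G. P (U n) G)" for n
  have "P (U n) (G n)" for n
    unfolding G_def by (rule someI_ex) (use from_nat_into[OF ne, of n] C(1) in \<open>auto simp: U_def\<close>)
  moreover have "\<exists>n. (H, B) \<in> U n" if "hermitian_mat H" "pd_mat B" for H B
    using in_C[OF that] from_nat_into_surj[OF C(2)] unfolding U_def by metis
  ultimately show thesis
    using that[of U G] unfolding P_def by blast
qed

lemma ennreal_le_of_exp_factor:
  fixes a b :: ennreal
  assumes "\<And>e. 0 < e \<Longrightarrow> a \<le> ennreal (exp e) * b"
  shows "a \<le> b"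
proof -
  have "(\<lambda>n. ennreal (exp (inverse (real (Suc n)))) * b) \<longlonglongrightarrow> ennreal (exp 0) * b"
    by (intro tendsto_mult_ennreal tendsto_ennrealI tendsto_exp tendsto_const LIMSEQ_inverse_real_of_nat) auto
  then have "(\<lambda>n. ennreal (exp (inverse (real (Suc n)))) * b) \<longlonglongrightarrow> b" by simp
  then show ?thesis by (rule LIMSEQ_le_const) (use assms in auto)
qed

context finite_measure_subalgebra
begin

text \<open>The pieces are \<open>F\<close>-measurable because \<open>H\<close> and the conditional
  expectation are, so on each of them the deterministic \<open>G n\<close> can be moved through the
  conditioning. The majorant \<open>S\<close> stands in for \<open>lieb (H x) (B x)\<close>, so that
  measurability of \<open>mat_log\<close> is never at issue.\<close>

lemma lieb_conditional_jensen:
  fixes H K :: "'a \<Rightarrow> complex ^ 'n ^ 'n"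
  assumes H [measurable]: "H \<in> borel_measurable F" and Hh: "\<And>x. x \<in> space M \<Longrightarrow> hermitian_mat (H x)"
    and K [measurable]: "K \<in> borel_measurable M" and Kh: "\<And>x. x \<in> space M \<Longrightarrow> hermitian_mat (K x)"
    and Z: "cond_integrable M F (\<lambda>x. mat_exp (K x))"
    and S [measurable]: "S \<in> borel_measurable F"
    and le: "AE x in M. lieb (H x) (mat_cond_exp M F (\<lambda>x. mat_exp (K x)) x) \<le> S x"
    and E [measurable]: "E \<in> sets F"
  shows "(\<integral>\<^sup>+x\<in>E. ennreal (re_trace (mat_exp (H x + K x))) \<partial>M) \<le> (\<integral>\<^sup>+x\<in>E. ennreal (S x) \<partial>M)"
proof (rule ennreal_le_of_exp_factor)
  fix e :: real assume e: "0 < e"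
  let ?Z = "\<lambda>x. mat_exp (K x)"
  define B where "B = mat_cond_exp M F ?Z"
  have Bm [measurable]: "B \<in> borel_measurable F" unfolding B_def by (rule borel_measurable_mat_cond_exp)
  have Bpd: "AE x in M. pd_mat (B x)" unfolding B_def by (rule mat_cond_exp_pd[OF Z K Kh])
  have HM [measurable]: "H \<in> borel_measurable M" and SM [measurable]: "S \<in> borel_measurable M"
    using measurable_from_subalg[OF subalg] H S by blast+
  have f_eq: "re_trace (mat_exp (H x + K x)) = lieb (H x) (?Z x)" if "x \<in> space M" for x
    using Kh[OF that] by (simp add: lieb_def mat_log_mat_exp)
  have Zpd: "pd_mat (?Z x)" if "x \<in> space M" for x using Kh[OF that] by (rule pd_mat_mat_exp)
  let ?f = "\<lambda>x. ennreal (re_trace (mat_exp (H x + K x)))"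
  have fm: "?f \<in> borel_measurable M"
    by (intro measurable_compose[OF _ measurable_ennreal] borel_measurable_re_trace borel_measurable_mat_exp) measurable
  obtain U :: "nat \<Rightarrow> ((complex ^ 'n ^ 'n) \<times> (complex ^ 'n ^ 'n)) set" and G where
    U: "\<And>n. open (U n)" "\<And>H B. hermitian_mat H \<Longrightarrow> pd_mat B \<Longrightarrow> \<exists>n. (H, B) \<in> U n"
    and G: "\<And>n A. pd_mat A \<Longrightarrow> 0 \<le> G n \<bullet> A"
    "\<And>n H B A. (H, B) \<in> U n \<Longrightarrow> hermitian_mat H \<Longrightarrow> pd_mat A \<Longrightarrow> lieb H A \<le> G n \<bullet> A"
    "\<And>n H B. (H, B) \<in> U n \<Longrightarrow> hermitian_mat H \<Longrightarrow> pd_mat B \<Longrightarrow> G n \<bullet> B \<le> exp e * lieb H B"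
    by (rule lieb_countable_bound[OF e]) blast
  define D where "D n = E \<inter> (\<lambda>x. (H x, B x)) -` U n" for n
  have EM: "E \<subseteq> space M" using sets.sets_into_space[OF E] subalg by (simp add: subalgebra_def)
  have D: "D n \<in> sets F" for n
  proof -
    have "(\<lambda>x. (H x, B x)) -` U n \<inter> space F \<in> sets F"
      using U(1) by (intro measurable_sets[of _ F borel] borel_open) measurable
    then have "E \<inter> ((\<lambda>x. (H x, B x)) -` U n \<inter> space F) \<in> sets F" by (rule sets.Int[OF E])
    also have "E \<inter> ((\<lambda>x. (H x, B x)) -` U n \<inter> space F) = D n"
      using sets.sets_into_space[OF E] by (auto simp: D_def)
    finally show ?thesis .
  qed
  have sub: "A \<in> sets M" if "A \<in> sets F" for A using that subalg by (auto simp: subalgebra_def)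
  let ?D = "disjointed D"
  have D': "?D n \<in> sets F" for n using sets.range_disjointed_sets[of D F] D by auto
  have D'U: "(H x, B x) \<in> U n" if "x \<in> ?D n" for x n
    using that disjointed_subset[of D n] by (auto simp: D_def)
  have piece: "(\<integral>\<^sup>+x\<in>?D n. ?f x \<partial>M) \<le> (\<integral>\<^sup>+x\<in>?D n. ennreal (exp e * S x) \<partial>M)" for n
  proof -
    have "(\<integral>\<^sup>+x\<in>?D n. ?f x \<partial>M) \<le> (\<integral>\<^sup>+x\<in>?D n. ennreal (G n \<bullet> ?Z x) \<partial>M)"
    proof (rule nn_integral_mono)
      fix x assume x: "x \<in> space M"
      show "?f x * indicator (?D n) x \<le> ennreal (G n \<bullet> ?Z x) * indicator (?D n) x"
        using G(2)[OF D'U Hh[OF x] Zpd[OF x], of n] f_eq[OF x]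
        by (cases "x \<in> ?D n") (auto intro: ennreal_leI)
    qed
    also have "\<dots> = (\<integral>\<^sup>+x\<in>?D n. ennreal (G n \<bullet> B x) \<partial>M)"
      unfolding B_def by (rule mat_cond_exp_nonneg_functional(2)[OF Z _ D']) (intro G(1) Zpd)
    also have "\<dots> \<le> (\<integral>\<^sup>+x\<in>?D n. ennreal (exp e * S x) \<partial>M)"
    proof (rule nn_integral_mono_AE)
      show "AE x in M. ennreal (G n \<bullet> B x) * indicator (?D n) x \<le> ennreal (exp e * S x) * indicator (?D n) x"
        using Bpd le AE_space
      proof eventually_elim
        case (elim x)
        show ?case
        proof (cases "x \<in> ?D n")
          case True
          have "G n \<bullet> B x \<le> exp e * lieb (H x) (B x)" by (rule G(3)[OF D'U[OF True] Hh[OF elim(3)] elim(1)])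
          also have "\<dots> \<le> exp e * S x" using elim(2) by (simp add: B_def)
          finally show ?thesis by (intro mult_right_mono ennreal_leI) auto
        qed simp
      qed
    qed
    finally show ?thesis .
  qed
  \<comment> \<open>The neighbourhoods cover only pairs with positive-definite second component, so
    the pieces exhaust \<open>E\<close> up to a null set.\<close>
  have AEU: "AE x in M. x \<in> E \<longleftrightarrow> x \<in> (\<Union>n. ?D n)"
    using Bpd AE_space
  proof eventually_elim
    case (elim x)
    have "\<exists>n. (H x, B x) \<in> U n" using U(2)[OF Hh[OF elim(2)] elim(1)] .
    then show ?case unfolding UN_disjointed_eq by (auto simp: D_def)
  qed
  have "(\<integral>\<^sup>+x\<in>E. ?f x \<partial>M) = (\<integral>\<^sup>+x\<in>(\<Union>n. ?D n). ?f x \<partial>M)"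
    using AEU by (intro nn_integral_cong_AE) (auto elim!: eventually_mono simp: indicator_def)
  also have "\<dots> = (\<Sum>n. \<integral>\<^sup>+x\<in>?D n. ?f x \<partial>M)"
    by (rule nn_integral_disjoint_family[OF fm sub[OF D'] disjoint_family_disjointed])
  also have "\<dots> \<le> (\<Sum>n. \<integral>\<^sup>+x\<in>?D n. ennreal (exp e * S x) \<partial>M)"
    by (intro suminf_le piece) auto
  also have "\<dots> = (\<integral>\<^sup>+x\<in>(\<Union>n. ?D n). ennreal (exp e * S x) \<partial>M)"
    by (rule nn_integral_disjoint_family[OF _ sub[OF D'] disjoint_family_disjointed, symmetric]) measurable
  also have "\<dots> = (\<integral>\<^sup>+x\<in>E. ennreal (exp e * S x) \<partial>M)"
    using AEU by (intro nn_integral_cong_AE) (auto elim!: eventually_mono simp: indicator_def)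
  also have "\<dots> = (\<integral>\<^sup>+x. ennreal (exp e) * (ennreal (S x) * indicator E x) \<partial>M)"
    by (intro nn_integral_cong) (simp add: ennreal_mult' mult.assoc)
  also have "\<dots> = ennreal (exp e) * (\<integral>\<^sup>+x\<in>E. ennreal (S x) \<partial>M)"
    using sub[OF E] by (intro nn_integral_cmult borel_measurable_times_ennreal borel_measurable_indicator
      measurable_compose[OF _ measurable_ennreal] SM)
  finally show "(\<integral>\<^sup>+x\<in>E. ?f x \<partial>M) \<le> ennreal (exp e) * (\<integral>\<^sup>+x\<in>E. ennreal (S x) \<partial>M)" .
qed

text \<open>Jensen is applied with \<open>H x - L x\<close> as the known part: by hypothesis adding
  the logarithm of the conditional expectation gives at most \<open>H x\<close>, and the trace
  exponential is monotone.\<close>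

lemma trace_exp_supermartingale_step:
  fixes H K L :: "'a \<Rightarrow> complex ^ 'n ^ 'n"
  assumes H [measurable]: "H \<in> borel_measurable F" and Hh: "\<And>x. x \<in> space M \<Longrightarrow> hermitian_mat (H x)"
    and L [measurable]: "L \<in> borel_measurable F" and Lh: "\<And>x. x \<in> space M \<Longrightarrow> hermitian_mat (L x)"
    and K: "K \<in> borel_measurable M" and Kh: "\<And>x. x \<in> space M \<Longrightarrow> hermitian_mat (K x)"
    and Z: "cond_integrable M F (\<lambda>x. mat_exp (K x))"
    and le: "AE x in M. mat_log (mat_cond_exp M F (\<lambda>x. mat_exp (K x)) x) \<preceq>\<^sub>L L x"
    and E: "E \<in> sets F"
  shows "(\<integral>\<^sup>+x\<in>E. ennreal (re_trace (mat_exp (H x - L x + K x))) \<partial>M)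
    \<le> (\<integral>\<^sup>+x\<in>E. ennreal (re_trace (mat_exp (H x))) \<partial>M)"
proof (rule lieb_conditional_jensen[OF _ _ K Kh Z _ _ E])
  show "(\<lambda>x. H x - L x) \<in> borel_measurable F" by measurable
  show "hermitian_mat (H x - L x)" if "x \<in> space M" for x
    using Hh[OF that] Lh[OF that] by (rule hermitian_mat_linear)
  show "(\<lambda>x. re_trace (mat_exp (H x))) \<in> borel_measurable F"
    by (intro borel_measurable_re_trace borel_measurable_mat_exp H)
  have "AE x in M. pd_mat (mat_cond_exp M F (\<lambda>x. mat_exp (K x)) x)"
    by (rule mat_cond_exp_pd[OF Z K Kh])
  then show "AE x in M. lieb (H x - L x) (mat_cond_exp M F (\<lambda>x. mat_exp (K x)) x) \<le> re_trace (mat_exp (H x))"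
    using le AE_space
  proof eventually_elim
    case (elim x)
    then show ?case unfolding lieb_def loewner_le_def
      by (intro re_trace_mat_exp_mono hermitian_mat_linear hermitian_mat_log Hh Lh) (simp_all add: algebra_simps)
  qed
qed

end

text \<open>Ville's maximal inequality by induction on the horizon, in place of a stopping time. No
  integrals are subtracted, so infinite values do no harm.\<close>

lemma nonneg_supermartingale_maximal:
  fixes S :: "nat \<Rightarrow> 'a \<Rightarrow> ennreal"
  assumes sub: "\<And>k. subalgebra M (F k)" and mono: "\<And>i j. i \<le> j \<Longrightarrow> sets (F i) \<subseteq> sets (F j)"
    and S: "\<And>k. S k \<in> borel_measurable (F k)"
    and step: "\<And>k E. E \<in> sets (F k) \<Longrightarrow> (\<integral>\<^sup>+x\<in>E. S (Suc k) x \<partial>M) \<le> (\<integral>\<^sup>+x\<in>E. S k x \<partial>M)"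
  shows "{x \<in> space M. \<exists>k. c \<le> S k x} \<in> sets M"
    and "c * emeasure M {x \<in> space M. \<exists>k. c \<le> S k x} \<le> (\<integral>\<^sup>+x. S 0 x \<partial>M)"
proof -
  have SM [measurable]: "S k \<in> borel_measurable M" for k by (rule measurable_from_subalg[OF sub S])
  have sp: "space (F k) = space M" and FM: "A \<in> sets (F k) \<Longrightarrow> A \<in> sets M" for k A
    using sub[of k] by (auto simp: subalgebra_def)
  show "{x \<in> space M. \<exists>k. c \<le> S k x} \<in> sets M" by measurable
  define A where "A n = {x \<in> space M. \<exists>k\<le>n. c \<le> S k x}" for n
  have lvl: "{x \<in> space M. c \<le> S k x} \<in> sets (F n)" if "k \<le> n" for k n
  proof -
    have "{x \<in> space (F k). c \<le> S k x} \<in> sets (F k)" using S[of k] by measurable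
    then show ?thesis using mono[OF that] unfolding sp by blast
  qed
  have A: "A n \<in> sets (F n)" for n
  proof -
    have "A n = (\<Union>k\<in>{..n}. {x \<in> space M. c \<le> S k x})" by (auto simp: A_def)
    then show ?thesis using lvl by auto
  qed
  have split: "c * emeasure M (N \<inter> {x \<in> space M. c \<le> S n x}) + (\<integral>\<^sup>+x\<in>N - {x \<in> space M. c \<le> S n x}. S n x \<partial>M)
      \<le> (\<integral>\<^sup>+x\<in>N. S n x \<partial>M)" if N [measurable]: "N \<in> sets M" for N n
  proof -
    let ?L = "{x \<in> space M. c \<le> S n x}"
    have [measurable]: "?L \<in> sets M" by measurable
    have "c * emeasure M (N \<inter> ?L) = (\<integral>\<^sup>+x. c * indicator (N \<inter> ?L) x \<partial>M)"
      by (rule nn_integral_cmult_indicator[symmetric]) measurable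
    also have "\<dots> \<le> (\<integral>\<^sup>+x\<in>N \<inter> ?L. S n x \<partial>M)"
      by (intro nn_integral_mono) (auto simp: indicator_def)
    finally have "c * emeasure M (N \<inter> ?L) + (\<integral>\<^sup>+x\<in>N - ?L. S n x \<partial>M)
        \<le> (\<integral>\<^sup>+x\<in>N \<inter> ?L. S n x \<partial>M) + (\<integral>\<^sup>+x\<in>N - ?L. S n x \<partial>M)" by (rule add_right_mono)
    also have "\<dots> = (\<integral>\<^sup>+x. S n x * indicator (N \<inter> ?L) x + S n x * indicator (N - ?L) x \<partial>M)"
      by (rule nn_integral_add[symmetric]) measurable
    also have "\<dots> = (\<integral>\<^sup>+x\<in>N. S n x \<partial>M)"
      by (intro nn_integral_cong) (auto simp: indicator_def)
    finally show ?thesis .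
  qed
  \<comment> \<open>The stopped process in disguise: paths that have reached \<open>c\<close> are
    charged \<open>c\<close> once, all others still carry \<open>S n\<close>, and the total never
    exceeds the initial integral.\<close>
  have ind: "c * emeasure M (A n) + (\<integral>\<^sup>+x\<in>space M - A n. S n x \<partial>M) \<le> (\<integral>\<^sup>+x. S 0 x \<partial>M)" for n
  proof (induction n)
    case 0
    have "space M \<inter> {x \<in> space M. c \<le> S 0 x} = A 0" "{x \<in> space M. c \<le> S 0 x} = A 0"
      by (auto simp: A_def)
    moreover have "(\<integral>\<^sup>+x\<in>space M. S 0 x \<partial>M) = (\<integral>\<^sup>+x. S 0 x \<partial>M)"
      by (intro nn_integral_cong) simp
    ultimately show ?case using split[of "space M" 0] by simp
  next
    case (Suc n)
    let ?L = "{x \<in> space M. c \<le> S (Suc n) x}" and ?N = "space M - A n"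
    have N: "?N \<in> sets (F n)" using A[of n] sets.compl_sets[of "A n" "F n"] by (simp add: sp)
    have un: "A (Suc n) = A n \<union> (?N \<inter> ?L)" "space M - A (Suc n) = ?N - ?L"
      by (auto simp: A_def le_Suc_eq)
    have "?N \<inter> ?L \<in> sets M" using FM[OF N] by measurable
    then have "emeasure M (A (Suc n)) = emeasure M (A n) + emeasure M (?N \<inter> ?L)"
      unfolding un(1) by (intro plus_emeasure[symmetric] FM[OF A]) auto
    then have "c * emeasure M (A (Suc n)) + (\<integral>\<^sup>+x\<in>space M - A (Suc n). S (Suc n) x \<partial>M)
      = c * emeasure M (A n) + (c * emeasure M (?N \<inter> ?L) + (\<integral>\<^sup>+x\<in>?N - ?L. S (Suc n) x \<partial>M))"
      unfolding un(2) by (simp add: distrib_left add.assoc)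
    also have "\<dots> \<le> c * emeasure M (A n) + (\<integral>\<^sup>+x\<in>?N. S (Suc n) x \<partial>M)"
      by (intro add_left_mono split FM[OF N])
    also have "\<dots> \<le> c * emeasure M (A n) + (\<integral>\<^sup>+x\<in>?N. S n x \<partial>M)"
      by (intro add_left_mono step N)
    also have "\<dots> \<le> (\<integral>\<^sup>+x. S 0 x \<partial>M)" by (rule Suc.IH)
    finally show ?case .
  qed
  have "incseq A" by (rule incseq_SucI) (auto simp: A_def intro: le_SucI)
  then have "(SUP n. emeasure M (A n)) = emeasure M (\<Union>n. A n)"
    using FM[OF A] by (intro SUP_emeasure_incseq) auto
  then have "c * emeasure M (\<Union>n. A n) = (SUP n. c * emeasure M (A n))"
    using SUP_mult_left_ennreal[of c "\<lambda>n. emeasure M (A n)" UNIV] by (simp only:)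
  moreover have "c * emeasure M (A n) \<le> (\<integral>\<^sup>+x. S 0 x \<partial>M)" for n
    by (rule order_trans[OF _ ind[of n]]) simp
  then have "(SUP n. c * emeasure M (A n)) \<le> (\<integral>\<^sup>+x. S 0 x \<partial>M)" by (rule SUP_least)
  moreover have "(\<Union>n. A n) = {x \<in> space M. \<exists>k. c \<le> S k x}" by (auto simp: A_def)
  ultimately show "c * emeasure M {x \<in> space M. \<exists>k. c \<le> S k x} \<le> (\<integral>\<^sup>+x. S 0 x \<partial>M)" by simp
qed

section \<open>Extreme eigenvalues and the tail event\<close>

lemma real_eigenvalues_spectral_mat:
  assumes U: "unitary_mat U"
  shows "real_eigenvalues (spectral_mat U l) = range l"
proof (intro equalityI subsetI)
  fix m assume "m \<in> real_eigenvalues (spectral_mat U l)"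
  then obtain v where v: "v \<noteq> 0" "spectral_mat U l *v v = of_real m *s v" by (auto simp: real_eigenvalues_def)
  let ?y = "conj_transpose U *v v"
  have Uy: "U *v ?y = v" by (simp add: matrix_vector_mul_assoc unitary_cancel[OF U])
  then have "?y \<noteq> 0" using v(1) by auto
  then obtain i where i: "?y $ i \<noteq> 0" by (auto simp: vec_eq_iff)
  have "diag_mat l *v ?y = conj_transpose U *v (spectral_mat U l *v v)"
    by (simp add: spectral_mat_def matrix_vector_mul_assoc matrix_mul_assoc unitary_cancel(3)[OF U])
  also have "\<dots> = of_real m *s ?y" by (simp add: v(2) matrix_vector_mult_scale)
  finally have "of_real (l i) * ?y $ i = of_real m * ?y $ i"
    by (metis diag_mat_vector_nth vector_smult_component)
  then show "m \<in> range l" using i by auto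
next
  fix m assume "m \<in> range l"
  then obtain i where "m = l i" by auto
  then show "m \<in> real_eigenvalues (spectral_mat U l)"
    using quad_form_eigenvector[OF U, of i] unfolding real_eigenvalues_def by (metis (mono_tags, lifting) mem_Collect_eq)
qed

text \<open>Bounding \<open>W\<close> by the scalar matrix \<open>w *\<^sub>R mat 1\<close> leaves
  something that commutes with \<open>Y\<close>; the trace then dominates the single eigenvalue that
  belongs to \<open>lambda_max Y\<close>.\<close>

lemma trace_exp_lambda_max_bound:
  assumes Y: "hermitian_mat Y" and W: "hermitian_mat W" and pos: "0 \<le> a" "0 \<le> c"
    and t: "t \<le> lambda_max Y" and w: "lambda_max W \<le> w"
  shows "exp (a * t - c * w) \<le> re_trace (mat_exp (a *\<^sub>R Y - c *\<^sub>R W))"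
proof -
  obtain U y where U: "unitary_mat U" and Yeq: "Y = spectral_mat U y" using hermitian_spectral[OF Y] .
  obtain U' v where U': "unitary_mat U'" and Weq: "W = spectral_mat U' v" using hermitian_spectral[OF W] .
  have "lambda_max Y \<in> range y"
    unfolding lambda_max_def Yeq real_eigenvalues_spectral_mat[OF U] by (intro Max_in) auto
  then obtain i where i: "t \<le> y i" using t by auto
  have v: "v j \<le> w" for j
    using w unfolding lambda_max_def Weq real_eigenvalues_spectral_mat[OF U'] by simp
  have eq: "a *\<^sub>R Y - (c * w) *\<^sub>R mat 1 = spectral_mat U (\<lambda>j. a * y j - c * w)"
    by (simp add: Yeq spectral_mat_const[OF U, symmetric] spectral_mat_linear)
  have "c *\<^sub>R (w *\<^sub>R mat 1 - W) = spectral_mat U' (\<lambda>j. c * (w - v j))"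
    by (simp add: Weq spectral_mat_const[OF U', symmetric] spectral_mat_linear)
  then have psd: "psd_mat (c *\<^sub>R (w *\<^sub>R mat 1 - W))"
    using v pos by (simp add: psd_mat_spectral_mat[OF U'])
  have "exp (a * t - c * w) \<le> exp (a * y i - c * w)" using i pos by (simp add: mult_left_mono)
  also have "\<dots> \<le> (\<Sum>j\<in>UNIV. exp (a * y j - c * w))" by (rule member_le_sum) auto
  also have "\<dots> = re_trace (mat_exp (a *\<^sub>R Y - (c * w) *\<^sub>R mat 1))"
    unfolding eq by (simp add: mat_exp_spectral_mat[OF U] re_trace_spectral_mat[OF U])
  also have "\<dots> \<le> re_trace (mat_exp (a *\<^sub>R Y - c *\<^sub>R W))"
    using Y W psd by (intro re_trace_mat_exp_mono hermitian_mat_linear) (simp_all add: algebra_simps)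
  finally show ?thesis .
qed

lemma lambda_max_maximal_inequality:
  fixes X V :: "nat \<Rightarrow> 'a \<Rightarrow> complex ^ 'n ^ 'n"
  assumes fs: "\<And>k. finite_measure_subalgebra M (F k)"
    and mono: "\<And>i j. i \<le> j \<Longrightarrow> sets (F i) \<subseteq> sets (F j)"
    and X: "\<And>k. k \<ge> 1 \<Longrightarrow> X k \<in> borel_measurable (F k)"
    and V: "\<And>k. k \<ge> 1 \<Longrightarrow> V k \<in> borel_measurable (F (k - 1))"
    and Xh: "\<And>k x. k \<ge> 1 \<Longrightarrow> x \<in> space M \<Longrightarrow> hermitian_mat (X k x)"
    and Vh: "\<And>k x. k \<ge> 1 \<Longrightarrow> x \<in> space M \<Longrightarrow> hermitian_mat (V k x)"
    and Z: "\<And>k. k \<ge> 1 \<Longrightarrow> cond_integrable M (F (k - 1)) (\<lambda>x. mat_exp (a *\<^sub>R X k x))"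
    and pos: "0 \<le> a" "0 \<le> c"
    and le: "\<And>k. k \<ge> 1 \<Longrightarrow> AE x in M.
      mat_log (mat_cond_exp M (F (k - 1)) (\<lambda>x. mat_exp (a *\<^sub>R X k x)) x) \<preceq>\<^sub>L c *\<^sub>R V k x"
  shows "emeasure M {x \<in> space M. \<exists>k::nat. lambda_max (\<Sum>j=1..k. X j x) \<ge> t \<and> lambda_max (\<Sum>j=1..k. V j x) \<le> w}
    \<le> of_nat CARD('n) * ennreal (exp (- a * t + c * w)) * emeasure M (space M)"
proof -
  have sub: "subalgebra M (F k)" for k using fs[of k] by (simp add: finite_measure_subalgebra_def finite_measure_subalgebra_axioms_def)
  have up: "f \<in> borel_measurable (F j)" if "f \<in> borel_measurable (F i)" "i \<le> j" for f :: "'a \<Rightarrow> complex ^ 'n ^ 'n" and i j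
    by (rule measurable_from_subalg[OF _ that(1)]) (use sub[of i] sub[of j] mono[OF that(2)] in \<open>auto simp: subalgebra_def\<close>)
  define Y where "Y k x = (\<Sum>j=1..k. X j x)" for k x
  define W where "W k x = (\<Sum>j=1..k. V j x)" for k x
  define H where "H k x = a *\<^sub>R Y k x - c *\<^sub>R W k x" for k x
  have Yh: "hermitian_mat (Y k x)" and Wh: "hermitian_mat (W k x)" if "x \<in> space M" for k x
    unfolding Y_def W_def using that by (auto intro!: hermitian_mat_sum Xh Vh)
  have Hh: "hermitian_mat (H k x)" if "x \<in> space M" for k x
    unfolding H_def using Yh[OF that] Wh[OF that] by (intro hermitian_mat_linear)
  have "X j \<in> borel_measurable (F k)" "V j \<in> borel_measurable (F k)" if "j \<in> {1..k}" for j k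
    using up[OF X[of j], of k] up[OF V[of j], of k] that by auto
  then have "Y k \<in> borel_measurable (F k)" "W k \<in> borel_measurable (F k)" for k
    unfolding Y_def W_def by (auto intro!: borel_measurable_sum)
  then have Hm: "H k \<in> borel_measurable (F k)" for k
    unfolding H_def by (intro borel_measurable_diff borel_measurable_scaleR borel_measurable_const)
  define S where "S k x = ennreal (re_trace (mat_exp (H k x)))" for k x
  have Sm: "S k \<in> borel_measurable (F k)" for k
    unfolding S_def
    by (intro measurable_compose[OF _ measurable_ennreal] borel_measurable_re_trace borel_measurable_mat_exp Hm)
  have step: "(\<integral>\<^sup>+x\<in>E. S (Suc k) x \<partial>M) \<le> (\<integral>\<^sup>+x\<in>E. S k x \<partial>M)" if E: "E \<in> sets (F k)" for k E
  proof -
    interpret finite_measure_subalgebra M "F k" by (rule fs)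
    \<comment> \<open>Previsibility enters here: \<open>V (Suc k)\<close> is already known at time k
      and can serve as the \<open>L\<close> of the supermartingale step.\<close>
    have "(\<lambda>x. c *\<^sub>R V (Suc k) x) \<in> borel_measurable (F k)"
      using V[of "Suc k"] by (intro borel_measurable_scaleR borel_measurable_const) simp
    moreover have "(\<lambda>x. a *\<^sub>R X (Suc k) x) \<in> borel_measurable M"
      using measurable_from_subalg[OF sub X[of "Suc k"]] by (intro borel_measurable_scaleR borel_measurable_const) simp
    ultimately have "(\<integral>\<^sup>+x\<in>E. ennreal (re_trace (mat_exp (H k x - c *\<^sub>R V (Suc k) x + a *\<^sub>R X (Suc k) x))) \<partial>M)
        \<le> (\<integral>\<^sup>+x\<in>E. ennreal (re_trace (mat_exp (H k x))) \<partial>M)"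
      using Z[of "Suc k"] le[of "Suc k"] E
      by (intro trace_exp_supermartingale_step Hm Hh hermitian_mat_linear Xh Vh) simp_all
    moreover have "H k x - c *\<^sub>R V (Suc k) x + a *\<^sub>R X (Suc k) x = H (Suc k) x" for x
      by (simp add: H_def Y_def W_def scaleR_add_right)
    ultimately show ?thesis by (simp add: S_def)
  qed
  \<comment> \<open>The empty sums vanish, and the trace of the identity is the origin of the
    dimensional factor.\<close>
  have S0: "S 0 x = of_nat CARD('n)" for x
  proof -
    have "unitary_mat (mat 1 :: complex ^ 'n ^ 'n)" by (simp add: unitary_mat_def)
    from mat_exp_spectral_mat[OF this, of "\<lambda>_. 0"] spectral_mat_const[OF this]
    have "mat_exp (0 :: complex ^ 'n ^ 'n) = spectral_mat (mat 1) (\<lambda>_. 1)" by simp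
    then have "re_trace (mat_exp (0 :: complex ^ 'n ^ 'n)) = real CARD('n)"
      by (simp add: re_trace_spectral_mat[OF \<open>unitary_mat _\<close>])
    then show ?thesis by (simp add: S_def H_def Y_def W_def ennreal_of_nat_eq_real_of_nat)
  qed
  let ?A = "{x \<in> space M. \<exists>k::nat. lambda_max (Y k x) \<ge> t \<and> lambda_max (W k x) \<le> w}"
  let ?u = "ennreal (exp (a * t - c * w))"
  let ?B = "{x \<in> space M. \<exists>k. ?u \<le> S k x}"
  note maximal = nonneg_supermartingale_maximal[where M = M and F = F and S = S, OF sub mono Sm step]
  \<comment> \<open>\<open>emeasure_mono\<close> asks for measurability of the larger set, which the
    maximal inequality supplies.\<close>
  have "?A \<subseteq> ?B"
    unfolding S_def H_def using Yh Wh pos by (blast intro: ennreal_leI trace_exp_lambda_max_bound)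
  then have "emeasure M ?A \<le> emeasure M ?B" using maximal(1) by (intro emeasure_mono)
  also have "\<dots> = ennreal (exp (- a * t + c * w)) * (?u * emeasure M ?B)"
    by (simp add: mult.assoc[symmetric] ennreal_mult'[symmetric] exp_add[symmetric])
  also have "\<dots> \<le> ennreal (exp (- a * t + c * w)) * (\<integral>\<^sup>+x. S 0 x \<partial>M)"
    by (intro mult_left_mono maximal(2) zero_le)
  finally show ?thesis by (simp add: S0 Y_def W_def mult_ac)
qed

theorem theorem2p3:
  fixes M :: "'a measure" and F :: "nat \<Rightarrow> 'a measure"
    and X V :: "nat \<Rightarrow> 'a \<Rightarrow> complex ^ 'n ^ 'n"
    and g :: "real \<Rightarrow> ennreal"
  assumes "prob_space M"
    and "filtration (space M) F"
    and "\<And>k. subalgebra M (F k)"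
    and "\<And>k. k \<ge> 1 \<Longrightarrow> X k \<in> borel_measurable (F k)"
    and "\<And>k. k \<ge> 1 \<Longrightarrow> V k \<in> borel_measurable (F (k - 1))"
    and "\<And>k \<omega>. k \<ge> 1 \<Longrightarrow> \<omega> \<in> space M \<Longrightarrow> hermitian_mat (X k \<omega>)"
    and "\<And>k \<omega>. k \<ge> 1 \<Longrightarrow> \<omega> \<in> space M \<Longrightarrow> hermitian_mat (V k \<omega>)"
    and "\<And>k \<theta>. k \<ge> 1 \<Longrightarrow> \<theta> > 0 \<Longrightarrow> g \<theta> \<noteq> \<infinity> \<Longrightarrow>
           cond_integrable M (F (k - 1)) (\<lambda>\<omega>. mat_exp (\<theta> *\<^sub>R X k \<omega>))"
  shows
    "((\<forall>\<theta>>0. g \<theta> \<noteq> \<infinity> \<longrightarrow> (\<forall>k\<ge>1. AE \<omega> in M.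
         mat_cond_exp M (F (k - 1)) (\<lambda>\<omega>'. mat_exp (\<theta> *\<^sub>R X k \<omega>')) \<omega>
           \<preceq>\<^sub>L mat_exp (enn2real (g \<theta>) *\<^sub>R V k \<omega>)))
      \<longrightarrow>
      (\<forall>\<theta>>0. g \<theta> \<noteq> \<infinity> \<longrightarrow> (\<forall>k\<ge>1. AE \<omega> in M.
         mat_log (mat_cond_exp M (F (k - 1)) (\<lambda>\<omega>'. mat_exp (\<theta> *\<^sub>R X k \<omega>')) \<omega>)
           \<preceq>\<^sub>L enn2real (g \<theta>) *\<^sub>R V k \<omega>)))
     \<and>
     ((\<forall>\<theta>>0. g \<theta> \<noteq> \<infinity> \<longrightarrow> (\<forall>k\<ge>1. AE \<omega> in M.
         mat_log (mat_cond_exp M (F (k - 1)) (\<lambda>\<omega>'. mat_exp (\<theta> *\<^sub>R X k \<omega>')) \<omega>)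
           \<preceq>\<^sub>L enn2real (g \<theta>) *\<^sub>R V k \<omega>))
      \<longrightarrow>
      (\<forall>t w :: real.
         emeasure M {\<omega> \<in> space M. \<exists>k::nat. lambda_max (\<Sum>j=1..k. X j \<omega>) \<ge> t \<and>
                                           lambda_max (\<Sum>j=1..k. V j \<omega>) \<le> w}
           \<le> of_nat CARD('n) * (INF \<theta>\<in>{0<..}. exp_bound (g \<theta>) \<theta> t w)))"
proof -
  interpret prob_space M by (rule assms(1))
  have fs: "finite_measure_subalgebra M (F k)" for k
    using assms(3)[of k] by unfold_locales
  have mono: "sets (F i) \<subseteq> sets (F j)" if "i \<le> j" for i j
    using filtration.sets_F_mono[OF assms(2) that] by simp
  show ?thesis
  proof (intro conjI impI allI)
    fix \<theta> :: real and k :: nat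
    assume hyp: "\<forall>\<theta>>0. g \<theta> \<noteq> \<infinity> \<longrightarrow> (\<forall>k\<ge>1. AE \<omega> in M.
         mat_cond_exp M (F (k - 1)) (\<lambda>\<omega>'. mat_exp (\<theta> *\<^sub>R X k \<omega>')) \<omega>
           \<preceq>\<^sub>L mat_exp (enn2real (g \<theta>) *\<^sub>R V k \<omega>))"
      and a: "0 < \<theta>" "g \<theta> \<noteq> \<infinity>" "1 \<le> k"
    interpret finite_measure_subalgebra M "F (k - 1)" by (rule fs)
    have "(\<lambda>\<omega>. \<theta> *\<^sub>R X k \<omega>) \<in> borel_measurable M"
      using measurable_from_subalg[OF assms(3) assms(4)[OF a(3)]]
      by (intro borel_measurable_scaleR borel_measurable_const)
    then have "AE \<omega> in M. pd_mat (mat_cond_exp M (F (k - 1)) (\<lambda>\<omega>'. mat_exp (\<theta> *\<^sub>R X k \<omega>')) \<omega>)"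
      using assms(6)[OF a(3)] assms(8)[OF a(3,1,2)] by (intro mat_cond_exp_pd hermitian_mat_linear)
    moreover have "AE \<omega> in M. mat_cond_exp M (F (k - 1)) (\<lambda>\<omega>'. mat_exp (\<theta> *\<^sub>R X k \<omega>')) \<omega>
           \<preceq>\<^sub>L mat_exp (enn2real (g \<theta>) *\<^sub>R V k \<omega>)"
      using hyp a by blast
    ultimately show "AE \<omega> in M. mat_log (mat_cond_exp M (F (k - 1)) (\<lambda>\<omega>'. mat_exp (\<theta> *\<^sub>R X k \<omega>')) \<omega>)
           \<preceq>\<^sub>L enn2real (g \<theta>) *\<^sub>R V k \<omega>"
      using AE_space
    proof eventually_elim
      case (elim \<omega>)
      have h: "hermitian_mat (enn2real (g \<theta>) *\<^sub>R V k \<omega>)"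
        using assms(7)[OF a(3) elim(3)] by (rule hermitian_mat_linear)
      \<comment> \<open>The logarithm undoes the exponential on the right; operator monotonicity
        applies because the conditional expectation is almost surely positive definite.\<close>
      show ?case
        using mat_log_mono[OF elim(1) pd_mat_mat_exp[OF h]] elim(2) by (simp add: loewner_le_def mat_log_mat_exp[OF h])
    qed
  next
    fix t w :: real
    assume hyp: "\<forall>\<theta>>0. g \<theta> \<noteq> \<infinity> \<longrightarrow> (\<forall>k\<ge>1. AE \<omega> in M.
         mat_log (mat_cond_exp M (F (k - 1)) (\<lambda>\<omega>'. mat_exp (\<theta> *\<^sub>R X k \<omega>')) \<omega>)
           \<preceq>\<^sub>L enn2real (g \<theta>) *\<^sub>R V k \<omega>)"
    let ?P = "emeasure M {\<omega> \<in> space M. \<exists>k::nat. lambda_max (\<Sum>j=1..k. X j \<omega>) \<ge> t \<and>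
                                           lambda_max (\<Sum>j=1..k. V j \<omega>) \<le> w}"
    let ?d = "of_nat CARD('n) :: ennreal"
    have d: "0 < ?d" "?d \<noteq> 0" "?d \<noteq> top" by simp_all
    have "?P \<le> ?d * exp_bound (g \<theta>) \<theta> t w" if "\<theta> > 0" for \<theta>
    proof (cases "g \<theta> = \<infinity>")
      case True
      then show ?thesis using d by (simp add: exp_bound_def ennreal_mult_top)
    next
      case False
      have "?P \<le> ?d * ennreal (exp (- \<theta> * t + enn2real (g \<theta>) * w)) * emeasure M (space M)"
      proof (rule lambda_max_maximal_inequality[where F = F])
        show "sets (F i) \<subseteq> sets (F j)" if "i \<le> j" for i j using that by (rule mono)
        show "cond_integrable M (F (k - 1)) (\<lambda>\<omega>. mat_exp (\<theta> *\<^sub>R X k \<omega>))" if "k \<ge> 1" for k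
          using that \<open>\<theta> > 0\<close> False by (rule assms(8))
        show "AE \<omega> in M. mat_log (mat_cond_exp M (F (k - 1)) (\<lambda>\<omega>'. mat_exp (\<theta> *\<^sub>R X k \<omega>')) \<omega>)
           \<preceq>\<^sub>L enn2real (g \<theta>) *\<^sub>R V k \<omega>" if "k \<ge> 1" for k
          using hyp that \<open>\<theta> > 0\<close> False by blast
      qed (use \<open>\<theta> > 0\<close> fs assms(4,5,6,7) in auto)
      then show ?thesis using False by (simp add: exp_bound_def emeasure_space_1)
    qed
    \<comment> \<open>The infimum is taken with the dimension divided out; multiplying back is exact
      because \<open>?d\<close> is finite and nonzero.\<close>
    then have "?P / ?d \<le> (INF \<theta>\<in>{0<..}. exp_bound (g \<theta>) \<theta> t w)"
      using d by (intro INF_greatest divide_le_posI_ennreal) auto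
    then have "?d * (?P / ?d) \<le> ?d * (INF \<theta>\<in>{0<..}. exp_bound (g \<theta>) \<theta> t w)"
      by (rule mult_left_mono) simp
    then show "?P \<le> ?d * (INF \<theta>\<in>{0<..}. exp_bound (g \<theta>) \<theta> t w)"
      using d by (simp add: ennreal_times_divide ennreal_mult_divide_eq mult.commute[of ?d])
  qed
qed

end
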